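(* Let $(X,d)$ be a separable metric space. (First part.) Let $\mu$ be a Borel probability measure with full support and finite $4$-th moment on $(X,d)$. Suppose that $s_-(T_\mu)=n$ and $s_+(T_\mu)=p$ are finite (nonnegative integers). Let $\lambda_i\in\mathbb R$, $i=1,\dots,n+p$, be the nonzero eigenvalues (counting multiplicities) of $T_\mu\colon L^2(X,\mu)\to L^2(X,\mu)$ and $u_i\in L^2(X,\mu)$ the respective orthonormal eigenfunctions, numbered so that $\lambda_i<0$ for $i=1,\dots,n$ and $\lambda_i>0$ for $i=n+1,\dots,n+p$. Then the map $f\colon X\to\mathbb R^{n,p}$ defined by $$f(x):=\left(\sqrt{|\lambda_i|}\,u_i(x)\right)_{i=1}^{n+p}$$ is an isometry onto its image, i.e. its image $\Sigma:=f(X)$ satisfies $\Sigma-\Sigma\subset C_{n,p}$ and $d_{n,p}(f(x),f(y))=d(x,y)$ for all $x,y\in X$. In particular, every finite metric space can be isometrically embedded into some pseudo-Euclidean space with image $\Sigma$ such that $\Sigma-\Sigma$ is contained in the positive cone. (Converse.) If $\mu$ is a Borel probability measure on $X$ with finite $4$-th moment (not necessarily of full support in $X$) and there is a map $f\colon X\to\mathbb R^{n,p}$ which is an isometry onto its image $\Sigma:=f(X)$ with $\Sigma-\Sigma\subset C_{n,p}$, then $s_-(T_\mu)\le n$ and $s_+(T_\mu)\le p$.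
   Context: For a compact self-adjoint operator $A$ on a Hilbert space, $s_+(A)$ and $s_-(A)$ denote the numbers of strictly positive, respectively strictly negative, eigenvalues of $A$, counted with multiplicity. A Borel probability measure $\mu$ on $X$ has full support if $\operatorname{supp}\mu=X$, and finite $4$-th moment if $\int_X d^4(x_0,y)\,d\mu(y)<+\infty$ for some (hence all) $x_0\in X$. For $\mu$ with finite $4$-th moment, the self-adjoint Hilbert–Schmidt operators $K_\mu,T_\mu$ on $L^2(X,\mu)$ are $$(K_\mu u)(x):=-\frac12\int_X d^2(x,y)u(y)\,d\mu(y),\qquad T_\mu:=P_\mu K_\mu P_\mu,$$ where $P_\mu$ is the orthogonal projector of $L^2(X,\mu)$ onto the orthogonal complement of the constant function $\mathbf 1$. The operator $T_\mu$ is an integral operator, $(T_\mu f)(x)=\int_X k_T(x,y)f(y)\,d\mu(y)$, with continuous kernel $$k_T(x,y)=k(x,y)-\int_X k(x,y')\,d\mu(y')-\int_X k(x',y)\,d\mu(x')+\int_X\int_X k(x',y')\,d\mu(x')\,d\mu(y'),\quad k(x,y):=-\tfrac12 d^2(x,y).$$ Eigenfunctions $u$ of $T_\mu$ for eigenvalues $\lambda\neq0$ are understood as their continuous representatives, given pointwise by $u(x)=\lambda^{-1}\int_X k_T(x,y)u(y)\,d\mu(y)$. The pseudo-Euclidean space $\mathbb R^{n,p}$ with signature $(n,p)$ is the linear space $\mathbb R^{n+p}$ with the bilinear form $(u,v):=-\sum_{i=1}^n u_iv_i+\sum_{j=n+1}^{n+p}u_jv_j$. Its positive cone is $C_{n,p}:=\{v\in\mathbb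 R^{n,p}:(v,v)\ge0\}$. For $\Sigma\subset\mathbb R^{n,p}$, $\Sigma-\Sigma:=\{u-v:u,v\in\Sigma\}$; when $\Sigma-\Sigma\subset C_{n,p}$ one sets $d_{n,p}(u,v):=\sqrt{(u-v,u-v)}$ for $u,v\in\Sigma$. An isometry onto the image is a map $f$ with $d_{n,p}(f(x),f(y))=d(x,y)$ for all $x,y\in X$. *)

theory Defs
  imports "HOL-Probability.Probability"
begin

section \<open>The real Hilbert space of square-integrable functions\<close>

text \<open>
  Elements of \<open>L\<^sup>2(\<mu>)\<close> are represented by square-integrable functions; equality in
  \<open>L\<^sup>2(\<mu>)\<close> is equality \<open>\<mu>\<close>-almost everywhere.  An operator on \<open>L\<^sup>2(\<mu>)\<close> is a map on
  representatives.
\<close>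

definition L2 :: "'a measure \<Rightarrow> ('a \<Rightarrow> real) set" where
  "L2 \<mu> = {u \<in> borel_measurable \<mu>. integrable \<mu> (\<lambda>x. (u x)\<^sup>2)}"

definition L2_inner :: "'a measure \<Rightarrow> ('a \<Rightarrow> real) \<Rightarrow> ('a \<Rightarrow> real) \<Rightarrow> real" where
  "L2_inner \<mu> u v = (\<integral>x. u x * v x \<partial>\<mu>)"

text \<open>Linear independence in \<open>L\<^sup>2(\<mu>)\<close> of the classes of the members of a finite set \<open>S\<close>.\<close>

definition L2_independent :: "'a measure \<Rightarrow> ('a \<Rightarrow> real) set \<Rightarrow> bool" where
  "L2_independent \<mu> S \<longleftrightarrow>
     (\<forall>c. (AE x in \<mu>. (\<Sum>u\<in>S. c u * u x) = 0) \<longrightarrow> (\<forall>u\<in>S. c u = 0))"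

definition eigenspace ::
    "'a measure \<Rightarrow> (('a \<Rightarrow> real) \<Rightarrow> 'a \<Rightarrow> real) \<Rightarrow> real \<Rightarrow> ('a \<Rightarrow> real) set" where
  "eigenspace \<mu> A c = {u \<in> L2 \<mu>. AE x in \<mu>. A u x = c * u x}"

text \<open>
  The dimension (possibly infinite) of the eigenspace in \<open>L\<^sup>2(\<mu>)\<close>; it is \<open>0\<close> exactly when
  \<open>c\<close> is not an eigenvalue.
\<close>

definition eigen_mult ::
    "'a measure \<Rightarrow> (('a \<Rightarrow> real) \<Rightarrow> 'a \<Rightarrow> real) \<Rightarrow> real \<Rightarrow> enat" where
  "eigen_mult \<mu> A c =
     (SUP S\<in>{S. finite S \<and> S \<subseteq> eigenspace \<mu> A c \<and> L2_independent \<mu> S}. enat (card S))"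

text \<open>
  The number of positive (negative) eigenvalues counted with multiplicity, i.e. the sum in
  \<open>[0, \<infinity>]\<close> of the multiplicities, written as the supremum of the finite partial sums.
\<close>

definition s_plus :: "'a measure \<Rightarrow> (('a \<Rightarrow> real) \<Rightarrow> 'a \<Rightarrow> real) \<Rightarrow> enat" where
  "s_plus \<mu> A = (SUP F\<in>{F. finite F \<and> F \<subseteq> {0<..}}. \<Sum>c\<in>F. eigen_mult \<mu> A c)"

definition s_minus :: "'a measure \<Rightarrow> (('a \<Rightarrow> real) \<Rightarrow> 'a \<Rightarrow> real) \<Rightarrow> enat" where
  "s_minus \<mu> A = (SUP F\<in>{F. finite F \<and> F \<subseteq> {..<0}}. \<Sum>c\<in>F. eigen_mult \<mu> A c)"

text \<open>
  The values \<open>lam 1, \<dots>, lam (n + p)\<close> list the nonzero eigenvalues of \<open>A\<close> with multiplicity,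
  the \<open>n\<close> negative ones first, and \<open>u 1, \<dots>, u (n + p)\<close> are corresponding orthonormal
  eigenfunctions.
\<close>

definition nonzero_eigensystem ::
    "'a measure \<Rightarrow> (('a \<Rightarrow> real) \<Rightarrow> 'a \<Rightarrow> real) \<Rightarrow> nat \<Rightarrow> nat \<Rightarrow>
     (nat \<Rightarrow> real) \<Rightarrow> (nat \<Rightarrow> 'a \<Rightarrow> real) \<Rightarrow> bool" where
  "nonzero_eigensystem \<mu> A n p lam u \<longleftrightarrow>
     (\<forall>i\<in>{1..n}. lam i < 0) \<and>
     (\<forall>i\<in>{n+1..n+p}. lam i > 0) \<and>
     (\<forall>c. c \<noteq> 0 \<longrightarrow> enat (card {i\<in>{1..n+p}. lam i = c}) = eigen_mult \<mu> A c) \<and>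
     (\<forall>i\<in>{1..n+p}. u i \<in> eigenspace \<mu> A (lam i)) \<and>
     (\<forall>i\<in>{1..n+p}. \<forall>j\<in>{1..n+p}. L2_inner \<mu> (u i) (u j) = (if i = j then 1 else 0))"


section \<open>Measures on a metric space and their operators\<close>

definition borel_prob :: "'a::topological_space measure \<Rightarrow> bool" where
  "borel_prob \<mu> \<longleftrightarrow> prob_space \<mu> \<and> sets \<mu> = sets borel"

definition supp :: "'a::topological_space measure \<Rightarrow> 'a set" where
  "supp \<mu> = {x. \<forall>U. open U \<and> x \<in> U \<longrightarrow> emeasure \<mu> U > 0}"

definition finite_4th_moment :: "'a::metric_space measure \<Rightarrow> bool" where
  "finite_4th_moment \<mu> \<longleftrightarrow> (\<exists>x0. integrable \<mu> (\<lambda>y. dist x0 y ^ 4))"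

definition K_op :: "'a::metric_space measure \<Rightarrow> ('a \<Rightarrow> real) \<Rightarrow> 'a \<Rightarrow> real" where
  "K_op \<mu> u = (\<lambda>x. - (1/2) * (\<integral>y. (dist x y)\<^sup>2 * u y \<partial>\<mu>))"

text \<open>
  The projector onto the orthogonal complement of the constant function \<open>1\<close>, which has norm
  \<open>1\<close> in \<open>L\<^sup>2(\<mu>)\<close> for a probability measure \<open>\<mu>\<close>; see \<open>P_op_orthogonal_projector\<close> below.
\<close>

definition P_op :: "'a measure \<Rightarrow> ('a \<Rightarrow> real) \<Rightarrow> 'a \<Rightarrow> real" where
  "P_op \<mu> u = (\<lambda>x. u x - L2_inner \<mu> u (\<lambda>_. 1) * 1)"

lemma P_op_orthogonal_projector:
  assumes "prob_space \<mu>" and u: "u \<in> L2 \<mu>"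
  shows "P_op \<mu> u \<in> L2 \<mu>"
    and "L2_inner \<mu> (P_op \<mu> u) (\<lambda>_. 1) = 0"
    and "\<And>v. v \<in> L2 \<mu> \<Longrightarrow> L2_inner \<mu> v (\<lambda>_. 1) = 0 \<Longrightarrow> L2_inner \<mu> (\<lambda>x. u x - P_op \<mu> u x) v = 0"
proof -
  interpret prob_space \<mu> by fact
  have int: "integrable \<mu> u"
    using u by (auto simp: L2_def intro: square_integrable_imp_integrable)
  show "P_op \<mu> u \<in> L2 \<mu>"
    using u int by (auto simp: L2_def P_op_def power2_diff)
  show "L2_inner \<mu> (P_op \<mu> u) (\<lambda>_. 1) = 0"
    using int by (simp add: L2_inner_def P_op_def prob_space)
  show "L2_inner \<mu> (\<lambda>x. u x - P_op \<mu> u x) v = 0"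
    if "v \<in> L2 \<mu>" "L2_inner \<mu> v (\<lambda>_. 1) = 0" for v
    using that by (simp add: L2_inner_def P_op_def)
qed

definition T_op :: "'a::metric_space measure \<Rightarrow> ('a \<Rightarrow> real) \<Rightarrow> 'a \<Rightarrow> real" where
  "T_op \<mu> u = P_op \<mu> (K_op \<mu> (P_op \<mu> u))"

definition kern :: "'a::metric_space \<Rightarrow> 'a \<Rightarrow> real" where
  "kern x y = - (1/2) * (dist x y)\<^sup>2"

definition kern_T :: "'a::metric_space measure \<Rightarrow> 'a \<Rightarrow> 'a \<Rightarrow> real" where
  "kern_T \<mu> x y = kern x y - (\<integral>y'. kern x y' \<partial>\<mu>) - (\<integral>x'. kern x' y \<partial>\<mu>)
     + (\<integral>x'. (\<integral>y'. kern x' y' \<partial>\<mu>) \<partial>\<mu>)"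

text \<open>
  The continuous representative of an eigenfunction \<open>u\<close> of \<open>T_op \<mu>\<close> for an eigenvalue
  \<open>c \<noteq> 0\<close>.  It depends only on the \<open>L\<^sup>2\<close>-class of \<open>u\<close>.
\<close>

definition cont_rep :: "'a::metric_space measure \<Rightarrow> real \<Rightarrow> ('a \<Rightarrow> real) \<Rightarrow> 'a \<Rightarrow> real" where
  "cont_rep \<mu> c u x = inverse c * (\<integral>y. kern_T \<mu> x y * u y \<partial>\<mu>)"


section \<open>Pseudo-Euclidean spaces\<close>

text \<open>
  Vectors of length \<open>n + p\<close> are functions on \<open>nat\<close> with coordinates indexed by
  \<open>{1..n+p}\<close> and value \<open>0\<close> elsewhere; addition and subtraction are pointwise.
\<close>

definition pe_space :: "nat \<Rightarrow> nat \<Rightarrow> (nat \<Rightarrow> real) set" where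
  "pe_space n p = {v. \<forall>i. i \<notin> {1..n+p} \<longrightarrow> v i = 0}"

definition pe_form :: "nat \<Rightarrow> nat \<Rightarrow> (nat \<Rightarrow> real) \<Rightarrow> (nat \<Rightarrow> real) \<Rightarrow> real" where
  "pe_form n p u v = - (\<Sum>i=1..n. u i * v i) + (\<Sum>j=n+1..n+p. u j * v j)"

definition pe_cone :: "nat \<Rightarrow> nat \<Rightarrow> (nat \<Rightarrow> real) set" where
  "pe_cone n p = {v \<in> pe_space n p. pe_form n p v v \<ge> 0}"

definition pe_dist :: "nat \<Rightarrow> nat \<Rightarrow> (nat \<Rightarrow> real) \<Rightarrow> (nat \<Rightarrow> real) \<Rightarrow> real" where
  "pe_dist n p u v = sqrt (pe_form n p (u - v) (u - v))"

definition difference_set :: "(nat \<Rightarrow> real) set \<Rightarrow> (nat \<Rightarrow> real) set" where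
  "difference_set S = {u - v | u v. u \<in> S \<and> v \<in> S}"

text \<open>
  Isometries onto the image of a metric space with carrier \<open>X\<close> and distance \<open>d\<close>.  The cone
  condition is part of the notion: without it \<open>pe_dist\<close> is not meaningful.
\<close>

definition pe_isometry ::
    "nat \<Rightarrow> nat \<Rightarrow> 'a set \<Rightarrow> ('a \<Rightarrow> 'a \<Rightarrow> real) \<Rightarrow> ('a \<Rightarrow> nat \<Rightarrow> real) \<Rightarrow> bool" where
  "pe_isometry n p X d f \<longleftrightarrow>
     f ` X \<subseteq> pe_space n p \<and>
     difference_set (f ` X) \<subseteq> pe_cone n p \<and>
     (\<forall>x\<in>X. \<forall>y\<in>X. pe_dist n p (f x) (f y) = d x y)"

definition spectral_map ::
    "'a::metric_space measure \<Rightarrow> nat \<Rightarrow> (nat \<Rightarrow> real) \<Rightarrow> (nat \<Rightarrow> 'a \<Rightarrow> real) \<Rightarrow> 'a \<Rightarrow> nat \<Rightarrow> real" where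
  "spectral_map \<mu> m lam u x =
     (\<lambda>i. if i \<in> {1..m} then sqrt \<bar>lam i\<bar> * cont_rep \<mu> (lam i) (u i) x else 0)"

end

theory Submission
  imports Defs "HOL-Library.Diagonal_Subsequence"
begin

text \<open>
  The double centring in \<open>kern_T\<close> cancels in \<open>kern_T x x + kern_T y y - 2 * kern_T x y\<close>, which
  equals \<open>dist x y ^ 2\<close>.  So the spectral map is an isometry as soon as \<open>kern_T x y\<close> equals
  \<open>\<Sum>i. lam i * u i x * u i y\<close> everywhere.  The operator vanishes on the orthogonal complement of
  the \<open>u i\<close>, since otherwise compactness would produce one more eigenfunction there.  For fixed
  \<open>x\<close>, the remainder \<open>R = kern_T x - (\<Sum>i. lam i * u i x * u i)\<close> lies in this complement and the
  operator maps it to a function whose value at \<open>x\<close> is \<open>\<parallel>R\<parallel>\<^sup>2\<close>; continuity and full support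
  then give \<open>R = 0\<close> pointwise.

  For the converse, an isometry \<open>f\<close> need not be measurable, because null directions of the
  pseudo-Euclidean form are not controlled by the metric.  But \<open>f\<close> makes the kernel of finite
  rank, and a skeleton decomposition of the kernel replaces \<open>f\<close> by a measurable, square-integrable
  map.  The quadratic form of \<open>T\<close> then becomes a signed sum of \<open>n + p\<close> squares of linear
  functionals, which bounds the number of eigenvalues of each sign.
\<close>

section \<open>Square-integrable functions\<close>

lemma L2_measurable [measurable_dest]: "f \<in> L2 M \<Longrightarrow> f \<in> borel_measurable M"
  by (simp add: L2_def)

lemma L2_mult_integrable:
  assumes "f \<in> L2 M" "g \<in> L2 M"
  shows "integrable M (\<lambda>x. f x * g x)"
proof (rule Bochner_Integration.integrable_bound)
  show "integrable M (\<lambda>x. (f x)\<^sup>2 + (g x)\<^sup>2)"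
    using assms by (auto simp: L2_def)
  show "(\<lambda>x. f x * g x) \<in> borel_measurable M"
    using assms by (auto simp: L2_def)
  have "\<bar>a * b\<bar> \<le> a\<^sup>2 + b\<^sup>2" for a b :: real
  proof -
    have "0 \<le> (\<bar>a\<bar> - \<bar>b\<bar>)\<^sup>2" by simp
    then have "2 * (\<bar>a\<bar> * \<bar>b\<bar>) \<le> a\<^sup>2 + b\<^sup>2" by (simp add: power2_diff)
    moreover have "0 \<le> \<bar>a\<bar> * \<bar>b\<bar>" by simp
    ultimately have "\<bar>a\<bar> * \<bar>b\<bar> \<le> a\<^sup>2 + b\<^sup>2" by linarith
    then show ?thesis by (simp add: abs_mult)
  qed
  then show "AE x in M. norm (f x * g x) \<le> norm ((f x)\<^sup>2 + (g x)\<^sup>2)"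
    by auto
qed

lemma L2_bound:
  assumes "g \<in> L2 M" "f \<in> borel_measurable M" "AE x in M. \<bar>f x\<bar> \<le> \<bar>g x\<bar>"
  shows "f \<in> L2 M"
proof -
  have "integrable M (\<lambda>x. (f x)\<^sup>2)"
  proof (rule Bochner_Integration.integrable_bound)
    show "integrable M (\<lambda>x. (g x)\<^sup>2)" using assms by (simp add: L2_def)
    show "AE x in M. norm ((f x)\<^sup>2) \<le> norm ((g x)\<^sup>2)"
      using assms(3) by eventually_elim (simp add: abs_le_square_iff)
    show "(\<lambda>x. (f x)\<^sup>2) \<in> borel_measurable M" using assms(2) by simp
  qed
  with assms show ?thesis by (simp add: L2_def)
qed

lemma L2_scale: "f \<in> L2 M \<Longrightarrow> (\<lambda>x. c * f x) \<in> L2 M"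
  by (auto simp: L2_def power_mult_distrib)

lemma L2_add:
  assumes "f \<in> L2 M" "g \<in> L2 M"
  shows "(\<lambda>x. f x + g x) \<in> L2 M"
  using assms L2_mult_integrable[OF assms] by (auto simp: L2_def power2_sum mult.assoc)

lemma L2_diff:
  assumes "f \<in> L2 M" "g \<in> L2 M"
  shows "(\<lambda>x. f x - g x) \<in> L2 M"
  using L2_add[OF assms(1) L2_scale[OF assms(2), of "-1"]] by simp

lemma L2_zero: "(\<lambda>x. 0) \<in> L2 M"
  by (simp add: L2_def)

lemma L2_sum: "(\<And>i. i \<in> I \<Longrightarrow> f i \<in> L2 M) \<Longrightarrow> (\<lambda>x. \<Sum>i\<in>I. f i x) \<in> L2 M"
  by (induction I rule: infinite_finite_induct) (simp_all add: L2_zero L2_add)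

lemma L2_abs: "f \<in> L2 M \<Longrightarrow> (\<lambda>x. \<bar>f x\<bar>) \<in> L2 M"
  by (auto simp: L2_def)

lemma (in prob_space) L2_const: "(\<lambda>x. c) \<in> L2 M"
  by (simp add: L2_def)

lemma L2_inner_commute: "L2_inner M f g = L2_inner M g f"
  by (simp add: L2_inner_def mult.commute)

lemma L2_inner_add_left:
  "f \<in> L2 M \<Longrightarrow> g \<in> L2 M \<Longrightarrow> h \<in> L2 M \<Longrightarrow>
    L2_inner M (\<lambda>x. f x + g x) h = L2_inner M f h + L2_inner M g h"
  by (simp add: L2_inner_def distrib_right L2_mult_integrable)

lemma L2_inner_diff_left:
  "f \<in> L2 M \<Longrightarrow> g \<in> L2 M \<Longrightarrow> h \<in> L2 M \<Longrightarrow>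
    L2_inner M (\<lambda>x. f x - g x) h = L2_inner M f h - L2_inner M g h"
  by (simp add: L2_inner_def left_diff_distrib L2_mult_integrable)

lemma L2_inner_scale_left: "L2_inner M (\<lambda>x. c * f x) h = c * L2_inner M f h"
  by (simp add: L2_inner_def mult.assoc)

lemma L2_inner_sum_left:
  "(\<And>i. i \<in> I \<Longrightarrow> f i \<in> L2 M) \<Longrightarrow> h \<in> L2 M \<Longrightarrow>
    L2_inner M (\<lambda>x. \<Sum>i\<in>I. f i x) h = (\<Sum>i\<in>I. L2_inner M (f i) h)"
  by (simp add: L2_inner_def sum_distrib_right Bochner_Integration.integral_sum L2_mult_integrable)

lemma L2_inner_add_right:
  "f \<in> L2 M \<Longrightarrow> g \<in> L2 M \<Longrightarrow> h \<in> L2 M \<Longrightarrow>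
    L2_inner M h (\<lambda>x. f x + g x) = L2_inner M h f + L2_inner M h g"
  by (simp add: L2_inner_def distrib_left L2_mult_integrable)

lemma L2_inner_diff_right:
  "f \<in> L2 M \<Longrightarrow> g \<in> L2 M \<Longrightarrow> h \<in> L2 M \<Longrightarrow>
    L2_inner M h (\<lambda>x. f x - g x) = L2_inner M h f - L2_inner M h g"
  by (simp add: L2_inner_def right_diff_distrib L2_mult_integrable)

lemma L2_inner_scale_right: "L2_inner M h (\<lambda>x. c * f x) = c * L2_inner M h f"
  by (simp add: L2_inner_def mult.left_commute)

lemma L2_inner_sum_right:
  "(\<And>i. i \<in> I \<Longrightarrow> f i \<in> L2 M) \<Longrightarrow> h \<in> L2 M \<Longrightarrow>
    L2_inner M h (\<lambda>x. \<Sum>i\<in>I. f i x) = (\<Sum>i\<in>I. L2_inner M h (f i))"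
  by (simp add: L2_inner_def sum_distrib_left Bochner_Integration.integral_sum L2_mult_integrable)

lemma L2_inner_cong:
  assumes "f \<in> borel_measurable M" "f' \<in> borel_measurable M" "g \<in> borel_measurable M"
    and "AE x in M. f x = f' x"
  shows "L2_inner M f g = L2_inner M f' g"
  unfolding L2_inner_def
  using assms by (intro integral_cong_AE) auto

lemma L2_inner_self_nonneg: "0 \<le> L2_inner M f f"
  by (simp add: L2_inner_def)

lemma L2_inner_self_eq_0:
  assumes "f \<in> L2 M"
  shows "L2_inner M f f = 0 \<longleftrightarrow> (AE x in M. f x = 0)"
proof -
  have "L2_inner M f f = 0 \<longleftrightarrow> (AE x in M. f x * f x = 0)"
    unfolding L2_inner_def
    by (rule integral_nonneg_eq_0_iff_AE) (use L2_mult_integrable[OF assms assms] in auto)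
  then show ?thesis by simp
qed

text \<open>The squared norm of \<open>f - t * g\<close> is a nonnegative quadratic in
  \<open>t\<close>, evaluated at its minimum \<open>?b / ?c\<close>. If \<open>?c = 0\<close> there
  is no such point, but then \<open>g\<close> is null and so is the inner product.\<close>

lemma L2_Cauchy_Schwarz:
  assumes "f \<in> L2 M" "g \<in> L2 M"
  shows "(L2_inner M f g)\<^sup>2 \<le> L2_inner M f f * L2_inner M g g"
proof -
  let ?a = "L2_inner M f f" and ?b = "L2_inner M f g" and ?c = "L2_inner M g g"
  have quad: "0 \<le> ?a - 2 * t * ?b + t\<^sup>2 * ?c" for t
  proof -
    have "0 \<le> L2_inner M (\<lambda>x. f x - t * g x) (\<lambda>x. f x - t * g x)"
      by (rule L2_inner_self_nonneg)
    also have "\<dots> = ?a - 2 * t * ?b + t\<^sup>2 * ?c"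
      using assms
      by (simp add: L2_inner_diff_left L2_inner_diff_right L2_diff L2_scale L2_inner_scale_left
          L2_inner_scale_right L2_inner_commute[of M g f] power2_eq_square algebra_simps)
    finally show ?thesis .
  qed
  show ?thesis
  proof (cases "?c = 0")
    case True
    then have "AE x in M. g x = 0" using assms by (simp add: L2_inner_self_eq_0)
    then have "?b = 0"
      using assms L2_inner_cong[of g M "\<lambda>x. 0" f]
      by (simp add: L2_inner_commute[of M f g] L2_measurable) (simp add: L2_inner_def)
    then show ?thesis by (simp add: True)
  next
    case False
    then have c: "?c > 0" using L2_inner_self_nonneg[of M g] by simp
    have "0 \<le> ?a - ?b\<^sup>2 / ?c"
      using quad[of "?b / ?c"] c by (simp add: power2_eq_square field_simps)
    then show ?thesis using c by (simp add: field_simps)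
  qed
qed

text \<open>Dominated convergence with the integrable majorant
  \<open>\<bar>u x\<bar> * \<bar>v x\<bar>\<close>. It turns pointwise convergence under
  square-integrable bounds into convergence of inner products.\<close>

lemma L2_inner_tendsto:
  assumes fm: "\<And>n. f n \<in> borel_measurable M" "f' \<in> borel_measurable M"
    and gm: "\<And>n. g n \<in> borel_measurable M" "g' \<in> borel_measurable M"
    and uv: "u \<in> L2 M" "v \<in> L2 M"
    and fl: "\<And>x. (\<lambda>n. f n x) \<longlonglongrightarrow> f' x" and gl: "\<And>x. (\<lambda>n. g n x) \<longlonglongrightarrow> g' x"
    and fb: "\<And>n x. \<bar>f n x\<bar> \<le> \<bar>u x\<bar>" and gb: "\<And>n x. \<bar>g n x\<bar> \<le> \<bar>v x\<bar>"
  shows "(\<lambda>n. L2_inner M (f n) (g n)) \<longlonglongrightarrow> L2_inner M f' g'"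
  unfolding L2_inner_def
proof (rule integral_dominated_convergence)
  show "integrable M (\<lambda>x. \<bar>u x\<bar> * \<bar>v x\<bar>)"
    using uv by (intro L2_mult_integrable L2_abs)
  show "AE x in M. (\<lambda>n. f n x * g n x) \<longlonglongrightarrow> f' x * g' x"
    using fl gl by (auto intro!: tendsto_mult)
  show "AE x in M. norm (f n x * g n x) \<le> \<bar>u x\<bar> * \<bar>v x\<bar>" for n
    using fb gb by (auto simp: abs_mult intro!: mult_mono)
  show "(\<lambda>x. f' x * g' x) \<in> borel_measurable M" "\<And>n. (\<lambda>x. f n x * g n x) \<in> borel_measurable M"
    by (intro borel_measurable_times fm gm)+
qed

lemma L2_dominated_limit:
  assumes fm: "\<And>n. f n \<in> borel_measurable M" and u: "u \<in> L2 M"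
    and fl: "\<And>x. (\<lambda>n. f n x) \<longlonglongrightarrow> f' x" and fb: "\<And>n x. \<bar>f n x\<bar> \<le> \<bar>u x\<bar>"
  shows "f' \<in> L2 M"
proof (rule L2_bound[OF u])
  show "f' \<in> borel_measurable M"
    by (rule borel_measurable_LIMSEQ_metric[of f]) (use fm fl in auto)
  have "\<bar>f' x\<bar> \<le> \<bar>u x\<bar>" for x
    by (rule LIMSEQ_le_const2[OF tendsto_rabs[OF fl]]) (use fb in blast)
  then show "AE x in M. \<bar>f' x\<bar> \<le> \<bar>u x\<bar>" by simp
qed

section \<open>Continuous symmetric kernels\<close>

text \<open>Cantor's diagonal argument: Bolzano-Weierstrass at each point of the countable set, with
  a bound that may depend on the point.\<close>

lemma pointwise_bounded_subseq:
  fixes f :: "nat \<Rightarrow> 'a \<Rightarrow> real"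
  assumes D: "countable D" and bdd: "\<And>n z. \<bar>f n z\<bar> \<le> b z"
  obtains r :: "nat \<Rightarrow> nat" where "strict_mono r" "\<forall>z\<in>D. convergent (\<lambda>n. f (r n) z)"
proof (cases "D = {}")
  case True
  then show ?thesis using that[of id] by (simp add: strict_mono_def)
next
  case False
  let ?P = "\<lambda>k s. convergent (\<lambda>n. f (s n) (from_nat_into D k))"
  interpret subseqs ?P
  proof
    fix k and s :: "nat \<Rightarrow> nat"
    let ?z = "from_nat_into D k"
    have "\<forall>n. f (s n) ?z \<in> {- b ?z .. b ?z}"
      using bdd[of _ ?z] by (auto simp: abs_le_iff minus_le_iff)
    then obtain l r where "strict_mono r" "((\<lambda>n. f (s n) ?z) \<circ> r) \<longlonglongrightarrow> l"
      using compact_Icc[of "- b ?z" "b ?z"] unfolding compact_eq_seq_compact_metric seq_compact_def by metis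
    then show "\<exists>r. strict_mono r \<and> convergent (\<lambda>n. f ((s \<circ> r) n) ?z)"
      by (auto simp: convergent_def o_def)
  qed
  have "convergent (\<lambda>n. f (diagseq n) z)" if z: "z \<in> D" for z
  proof -
    obtain k where k: "from_nat_into D k = z" using from_nat_into_surj[OF D z] by blast
    have "?P k (diagseq \<circ> (+) (Suc k))"
    proof (rule diagseq_holds)
      fix r s :: "nat \<Rightarrow> nat" and k
      assume "strict_mono r" "?P k s"
      then show "?P k (s \<circ> r)"
        using convergent_subseq_convergent[of "\<lambda>n. f (s n) (from_nat_into D k)" r] by (simp add: o_def)
    qed
    then have "convergent (\<lambda>n. f (diagseq (n + Suc k)) z)" by (simp add: o_def k add.commute)
    then show ?thesis
      using convergent_ignore_initial_segment[of "\<lambda>n. f (diagseq n) z" "Suc k"] by simp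
  qed
  then show ?thesis using that subseq_diagseq by blast
qed

lemma L2_inner_abs_le:
  assumes "f \<in> L2 M" "g \<in> L2 M"
  shows "\<bar>L2_inner M f g\<bar> \<le> sqrt (L2_inner M f f) * sqrt (L2_inner M g g)"
  using real_sqrt_le_mono[OF L2_Cauchy_Schwarz[OF assms]] by (simp add: real_sqrt_mult)

lemma (in pair_sigma_finite) integrable_times_pair:
  fixes f g :: "_ \<Rightarrow> real"
  assumes f: "integrable M1 f" and g: "integrable M2 g"
  shows "integrable (M1 \<Otimes>\<^sub>M M2) (\<lambda>(x, y). f x * g y)"
proof (rule Fubini_integrable)
  show "(\<lambda>(x, y). f x * g y) \<in> borel_measurable (M1 \<Otimes>\<^sub>M M2)"
    using f g by measurable
  show "integrable M1 (\<lambda>x. \<integral>y. norm (case (x, y) of (x, y) \<Rightarrow> f x * g y) \<partial>M2)"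
    using f by (simp add: abs_mult)
  show "AE x in M1. integrable M2 (\<lambda>y. case (x, y) of (x, y) \<Rightarrow> f x * g y)"
    using g by simp
qed

section \<open>Integral operators with a dominated symmetric kernel\<close>

text \<open>The product bound by a continuous square-integrable \<open>w\<close> supplies every
  majorant for dominated convergence and for Fubini. Joint measurability is listed apart from
  continuity of the rows because Fubini works on the product sigma-algebra; \<open>D\<close> carries
  the diagonal argument.\<close>

locale dominated_kernel = prob_space \<mu> for \<mu> :: "'a::metric_space measure" +
  fixes k :: "'a \<Rightarrow> 'a \<Rightarrow> real" and w :: "'a \<Rightarrow> real" and D :: "'a set"
  assumes sets_eq: "sets \<mu> = sets borel"
    and countable_D: "countable D" and dense_D: "closure D = UNIV"
    and k_pair_measurable: "(\<lambda>(x, y). k x y) \<in> borel_measurable (\<mu> \<Otimes>\<^sub>M \<mu>)"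
    and sym: "k x y = k y x"
    and cont: "continuous_on UNIV (k x)"
    and w_cont: "continuous_on UNIV w"
    and w_nonneg: "0 \<le> w x"
    and w_L2: "w \<in> L2 \<mu>"
    and bound: "\<bar>k x y\<bar> \<le> w x * w y"
begin

text \<open>The value is defined at every point, so the image of a class is one definite function,
  and a continuous one.\<close>

definition Kop :: "('a \<Rightarrow> real) \<Rightarrow> 'a \<Rightarrow> real" where
  "Kop f x = L2_inner \<mu> (k x) f"

lemma continuous_measurable: "continuous_on UNIV f \<Longrightarrow> f \<in> borel_measurable \<mu>"
  for f :: "'a \<Rightarrow> real"
  using borel_measurable_continuous_onI sets_eq by (simp cong: measurable_cong_sets)

lemma row_L2: "k x \<in> L2 \<mu>"
proof (rule L2_bound[OF L2_scale[OF w_L2]])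
  show "AE y in \<mu>. \<bar>k x y\<bar> \<le> \<bar>w x * w y\<bar>"
    using bound[of x] by (intro AE_I2) (meson abs_ge_self order_trans)
qed (rule continuous_measurable[OF cont])

lemma column_tendsto: "z \<longlonglongrightarrow> x \<Longrightarrow> (\<lambda>n. k (z n) y) \<longlonglongrightarrow> k x y"
  using continuous_on_tendsto_compose[OF cont, of z x sequentially y] by (simp add: sym[of _ y])

text \<open>The weights \<open>w (z n)\<close> along a convergent sequence are bounded, so a single
  multiple of \<open>w\<close> dominates all the rows and their differences from the limit
  row.\<close>

lemma row_uniform_bound:
  assumes "z \<longlonglongrightarrow> x"
  shows "\<exists>C. \<forall>n y. \<bar>k (z n) y\<bar> \<le> \<bar>C * w y\<bar> \<and> \<bar>k (z n) y - k x y\<bar> \<le> \<bar>C * w y\<bar>"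
proof -
  have "(\<lambda>n. w (z n)) \<longlonglongrightarrow> w x"
    using continuous_on_tendsto_compose[OF w_cont assms] by simp
  then have "Bseq (\<lambda>n. w (z n))" by (intro convergent_imp_Bseq convergentI)
  then obtain C where C: "0 < C" "\<And>n. \<bar>w (z n)\<bar> \<le> C" by (auto simp: Bseq_def)
  have 1: "\<bar>k (z n) y\<bar> \<le> C * w y" for n y
    using bound[of "z n" y] mult_right_mono[of "w (z n)" C "w y"] C(2)[of n] w_nonneg[of y] by force
  have 2: "\<bar>k (z n) y - k x y\<bar> \<le> (C + w x) * w y" for n y
    using 1[of n y] bound[of x y] by (simp add: distrib_right)
  have 3: "0 \<le> w x * w y" for y by (simp add: w_nonneg)
  have 4: "\<bar>k (z n) y\<bar> \<le> (C + w x) * w y" for n y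
    using 1[of n y] 3[of y] by (simp add: distrib_right)
  show ?thesis
    using order_trans[OF 4 abs_ge_self] order_trans[OF 2 abs_ge_self] by blast
qed

text \<open>Continuity of \<open>x \<mapsto> k x\<close> into the Hilbert space; through
  Cauchy-Schwarz it makes the images of the unit ball equicontinuous.\<close>

lemma row_dist_tendsto:
  assumes "z \<longlonglongrightarrow> x"
  shows "(\<lambda>n. L2_inner \<mu> (\<lambda>y. k (z n) y - k x y) (\<lambda>y. k (z n) y - k x y)) \<longlonglongrightarrow> 0"
proof -
  obtain C where C: "\<And>n y. \<bar>k (z n) y - k x y\<bar> \<le> \<bar>C * w y\<bar>"
    using row_uniform_bound[OF assms] by blast
  have lim: "(\<lambda>n. k (z n) y - k x y) \<longlonglongrightarrow> 0" for y
    using tendsto_diff[OF column_tendsto[OF assms, of y] tendsto_const[of "k x y"]] by simp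
  have "(\<lambda>n. L2_inner \<mu> (\<lambda>y. k (z n) y - k x y) (\<lambda>y. k (z n) y - k x y))
      \<longlonglongrightarrow> L2_inner \<mu> (\<lambda>y. 0) (\<lambda>y. 0)"
    by (rule L2_inner_tendsto[OF _ _ _ _ L2_scale[OF w_L2] L2_scale[OF w_L2] lim lim C C])
      (simp_all add: L2_measurable[OF L2_diff[OF row_L2 row_L2]])
  then show ?thesis by (simp add: L2_inner_def)
qed

lemma Kop_continuous:
  assumes f: "f \<in> L2 \<mu>"
  shows "continuous_on UNIV (Kop f)"
proof (clarsimp simp: continuous_on_sequentially o_def)
  fix z :: "nat \<Rightarrow> 'a" and x assume z: "z \<longlonglongrightarrow> x"
  obtain C where C: "\<And>n y. \<bar>k (z n) y\<bar> \<le> \<bar>C * w y\<bar>"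
    using row_uniform_bound[OF z] by blast
  show "(\<lambda>n. Kop f (z n)) \<longlonglongrightarrow> Kop f x"
    unfolding Kop_def
    by (rule L2_inner_tendsto[OF _ _ _ _ L2_scale[OF w_L2] f column_tendsto[OF z] tendsto_const C order_refl])
      (simp_all add: L2_measurable[OF row_L2] L2_measurable[OF f])
qed

text \<open>Cauchy-Schwarz, where the row \<open>k x\<close> has norm at most \<open>w x\<close>
  times the norm of \<open>w\<close>.\<close>

lemma Kop_bound:
  assumes f: "f \<in> L2 \<mu>"
  shows "\<bar>Kop f x\<bar> \<le> w x * (sqrt (L2_inner \<mu> w w) * sqrt (L2_inner \<mu> f f))"
proof -
  have "L2_inner \<mu> (k x) (k x) \<le> L2_inner \<mu> (\<lambda>y. w x * w y) (\<lambda>y. w x * w y)"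
    unfolding L2_inner_def
  proof (rule integral_mono)
    show "k x y * k x y \<le> w x * w y * (w x * w y)" for y
      using mult_mono[OF bound[of x y] bound[of x y]] by (simp add: w_nonneg flip: abs_mult)
  qed (intro L2_mult_integrable row_L2 L2_scale w_L2)+
  also have "\<dots> = (w x)\<^sup>2 * L2_inner \<mu> w w"
    by (simp add: L2_inner_scale_left L2_inner_scale_right power2_eq_square mult.assoc)
  finally have "sqrt (L2_inner \<mu> (k x) (k x)) \<le> w x * sqrt (L2_inner \<mu> w w)"
    using real_sqrt_le_mono by (fastforce simp: real_sqrt_mult w_nonneg)
  then have "sqrt (L2_inner \<mu> (k x) (k x)) * sqrt (L2_inner \<mu> f f)
      \<le> w x * sqrt (L2_inner \<mu> w w) * sqrt (L2_inner \<mu> f f)"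
    by (rule mult_right_mono) (simp add: L2_inner_self_nonneg)
  then show ?thesis
    using L2_inner_abs_le[OF row_L2[of x] f] by (simp add: Kop_def mult.assoc)
qed

lemma Kop_L2:
  assumes f: "f \<in> L2 \<mu>"
  shows "Kop f \<in> L2 \<mu>"
proof (rule L2_bound[OF L2_scale[OF w_L2]])
  let ?C = "sqrt (L2_inner \<mu> w w) * sqrt (L2_inner \<mu> f f)"
  show "AE x in \<mu>. \<bar>Kop f x\<bar> \<le> \<bar>?C * w x\<bar>"
    using Kop_bound[OF f] by (intro AE_I2) (metis abs_ge_self mult.commute order_trans)
qed (rule continuous_measurable[OF Kop_continuous[OF f]])

lemma Kop_pointwise_tendsto:
  assumes "\<And>n. f n \<in> borel_measurable \<mu>" "u \<in> L2 \<mu>"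
    and "\<And>x. (\<lambda>n. f n x) \<longlonglongrightarrow> g x" and "\<And>n x. \<bar>f n x\<bar> \<le> \<bar>u x\<bar>"
  shows "(\<lambda>n. Kop (f n) x) \<longlonglongrightarrow> Kop g x"
  unfolding Kop_def
  by (rule L2_inner_tendsto[OF _ _ assms(1) _ row_L2 assms(2) tendsto_const assms(3) order_refl assms(4)])
    (simp_all add: L2_measurable[OF row_L2] L2_measurable[OF L2_dominated_limit[OF assms]])

lemma Kop_add: "f \<in> L2 \<mu> \<Longrightarrow> g \<in> L2 \<mu> \<Longrightarrow> Kop (\<lambda>x. f x + g x) x = Kop f x + Kop g x"
  by (simp add: Kop_def L2_inner_add_right row_L2)

lemma Kop_diff: "f \<in> L2 \<mu> \<Longrightarrow> g \<in> L2 \<mu> \<Longrightarrow> Kop (\<lambda>x. f x - g x) x = Kop f x - Kop g x"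
  by (simp add: Kop_def L2_inner_diff_right row_L2)

lemma Kop_scale: "Kop (\<lambda>x. c * f x) x = c * Kop f x"
  by (simp add: Kop_def L2_inner_scale_right)

lemma Kop_sum:
  "(\<And>i. i \<in> I \<Longrightarrow> f i \<in> L2 \<mu>) \<Longrightarrow> Kop (\<lambda>x. \<Sum>i\<in>I. f i x) x = (\<Sum>i\<in>I. Kop (f i) x)"
  by (simp add: Kop_def L2_inner_sum_right row_L2)

text \<open>Fubini and the symmetry of \<open>k\<close>; the product bound makes the double
  integrand integrable.\<close>

lemma Kop_symmetric:
  assumes f: "f \<in> L2 \<mu>" and g: "g \<in> L2 \<mu>"
  shows "L2_inner \<mu> (Kop f) g = L2_inner \<mu> f (Kop g)"
proof -
  interpret pair_sigma_finite \<mu> \<mu> by (rule pair_sigma_finite.intro) unfold_locales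
  have int: "integrable (\<mu> \<Otimes>\<^sub>M \<mu>) (\<lambda>(x, y). k x y * f y * g x)"
  proof (rule Bochner_Integration.integrable_bound)
    show "integrable (\<mu> \<Otimes>\<^sub>M \<mu>) (\<lambda>(x, y). (w x * g x) * (w y * f y))"
      by (intro integrable_times_pair L2_mult_integrable w_L2 f g)
    have [measurable]: "f \<in> borel_measurable \<mu>" "g \<in> borel_measurable \<mu>"
      using f g by (simp_all add: L2_measurable)
    note k_pair_measurable [measurable]
    show "(\<lambda>(x, y). k x y * f y * g x) \<in> borel_measurable (\<mu> \<Otimes>\<^sub>M \<mu>)"
      by measurable
    have "\<bar>k x y\<bar> * (\<bar>f y\<bar> * \<bar>g x\<bar>) \<le> (w x * w y) * (\<bar>f y\<bar> * \<bar>g x\<bar>)" for x y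
      by (rule mult_right_mono[OF bound]) simp
    then show "AE x in \<mu> \<Otimes>\<^sub>M \<mu>. norm (case x of (x, y) \<Rightarrow> k x y * f y * g x)
        \<le> norm (case x of (x, y) \<Rightarrow> (w x * g x) * (w y * f y))"
      by (auto simp: abs_mult w_nonneg mult_ac)
  qed
  have "L2_inner \<mu> (Kop f) g = (\<integral>x. \<integral>y. k x y * f y * g x \<partial>\<mu> \<partial>\<mu>)"
    by (simp add: L2_inner_def Kop_def)
  also have "\<dots> = (\<integral>y. \<integral>x. k x y * f y * g x \<partial>\<mu> \<partial>\<mu>)"
    using Fubini_integral[OF int] by simp
  also have "\<dots> = (\<integral>y. \<integral>x. f y * (k y x * g x) \<partial>\<mu> \<partial>\<mu>)"
    by (simp add: sym mult_ac)
  also have "\<dots> = L2_inner \<mu> f (Kop g)"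
    by (simp add: L2_inner_def Kop_def)
  finally show ?thesis .
qed

section \<open>Compactness and existence of eigenfunctions\<close>

text \<open>An Arzela-Ascoli argument: the images of the unit ball are pointwise bounded and
  equicontinuous, so a subsequence converging on the dense set \<open>D\<close> converges at every
  point.\<close>

lemma Kop_compact:
  assumes f: "\<And>n. f n \<in> L2 \<mu>" and f1: "\<And>n. L2_inner \<mu> (f n) (f n) \<le> 1"
  obtains r :: "nat \<Rightarrow> nat" and g where "strict_mono r" "\<forall>x. (\<lambda>n. Kop (f (r n)) x) \<longlonglongrightarrow> g x"
proof -
  have bdd: "\<bar>Kop (f n) z\<bar> \<le> w z * (sqrt (L2_inner \<mu> w w) * 1)" for n z
    by (rule order_trans[OF Kop_bound[OF f]], intro mult_left_mono)
      (simp_all add: w_nonneg L2_inner_self_nonneg f1)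
  obtain r :: "nat \<Rightarrow> nat" where r: "strict_mono r" "\<forall>z\<in>D. convergent (\<lambda>n. Kop (f (r n)) z)"
    by (rule pointwise_bounded_subseq[where f = "\<lambda>n. Kop (f n)", OF countable_D bdd])
  have "convergent (\<lambda>n. Kop (f (r n)) x)" for x
  proof -
    have "x \<in> closure D" by (simp add: dense_D)
    then obtain z where z: "\<And>n. z n \<in> D" "z \<longlonglongrightarrow> x"
      unfolding closure_sequential by blast
    define e where "e n = sqrt (L2_inner \<mu> (\<lambda>y. k (z n) y - k x y) (\<lambda>y. k (z n) y - k x y))" for n
    have e0: "e \<longlonglongrightarrow> 0"
      using tendsto_real_sqrt[OF row_dist_tendsto[OF z(2)]] by (simp add: e_def[abs_def])
    \<comment> \<open>The bound \<open>e n\<close> does not depend on \<open>i\<close>: this is the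
      equicontinuity.\<close>
    have close: "\<bar>Kop (f i) (z n) - Kop (f i) x\<bar> \<le> e n" for i n
    proof -
      have "\<bar>Kop (f i) (z n) - Kop (f i) x\<bar> = \<bar>L2_inner \<mu> (\<lambda>y. k (z n) y - k x y) (f i)\<bar>"
        by (simp add: Kop_def L2_inner_diff_left row_L2 f)
      also have "\<dots> \<le> e n * sqrt (L2_inner \<mu> (f i) (f i))"
        unfolding e_def by (intro L2_inner_abs_le L2_diff row_L2 f)
      also have "\<dots> \<le> e n * 1"
        by (rule mult_left_mono) (simp_all add: f1 e_def L2_inner_self_nonneg)
      finally show ?thesis by simp
    qed
    have "Cauchy (\<lambda>n. Kop (f (r n)) x)"
    proof (rule metric_CauchyI)
      fix \<epsilon> :: real assume \<epsilon>: "0 < \<epsilon>"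
      then obtain m where m: "\<bar>e m\<bar> < \<epsilon> / 3"
        using LIMSEQ_D[OF e0, of "\<epsilon> / 3"] by auto
      have "Cauchy (\<lambda>n. Kop (f (r n)) (z m))"
        using r(2)[rule_format, OF z(1)] by (rule convergent_Cauchy)
      then obtain N where N: "\<And>i j. i \<ge> N \<Longrightarrow> j \<ge> N \<Longrightarrow> \<bar>Kop (f (r i)) (z m) - Kop (f (r j)) (z m)\<bar> < \<epsilon> / 3"
        using \<epsilon> unfolding Cauchy_def dist_real_def by (meson divide_pos_pos zero_less_numeral)
      have "dist (Kop (f (r i)) x) (Kop (f (r j)) x) < \<epsilon>" if "i \<ge> N" "j \<ge> N" for i j
        using N[OF that] m close[of "r i" m] close[of "r j" m] unfolding dist_real_def by linarith
      then show "\<exists>M. \<forall>m\<ge>M. \<forall>n\<ge>M. dist (Kop (f (r m)) x) (Kop (f (r n)) x) < \<epsilon>" by blast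
    qed
    then show ?thesis by (rule Cauchy_convergent)
  qed
  then show thesis using that[OF r(1)] unfolding convergent_def by metis
qed

text \<open>
  A sequence maximising \<open>\<parallel>Kop f\<parallel>\<close> over the unit ball of the orthogonal complement of \<open>U\<close> has
  images converging to some \<open>g\<close> with \<open>Kop (Kop g) = N * g\<close>, where \<open>N\<close> is the supremum of
  \<open>\<parallel>Kop f\<parallel>\<^sup>2\<close>; then \<open>g\<close> or \<open>Kop g + sqrt N * g\<close> is an eigenfunction.
\<close>

lemma exists_eigenfunction_orthogonal:
  assumes U: "U \<subseteq> L2 \<mu>" and Ueig: "\<And>u. u \<in> U \<Longrightarrow> \<exists>c. AE x in \<mu>. Kop u x = c * u x"
    and f0: "f0 \<in> L2 \<mu>" and f0U: "\<And>u. u \<in> U \<Longrightarrow> L2_inner \<mu> f0 u = 0"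
    and f0K: "L2_inner \<mu> (Kop f0) (Kop f0) \<noteq> 0"
  obtains v c where "v \<in> L2 \<mu>" "\<forall>u\<in>U. L2_inner \<mu> v u = 0" "c \<noteq> 0"
    "AE x in \<mu>. Kop v x = c * v x" "L2_inner \<mu> v v \<noteq> 0"
proof -
  define V where "V = {f \<in> L2 \<mu>. \<forall>u\<in>U. L2_inner \<mu> f u = 0}"
  define W where "W = sqrt (L2_inner \<mu> w w)"
  define S where "S = {L2_inner \<mu> (Kop f) (Kop f) | f. f \<in> V \<and> L2_inner \<mu> f f \<le> 1}"
  define N where "N = Sup S"
  have VL2: "f \<in> L2 \<mu>" if "f \<in> V" for f using that by (simp add: V_def)
  have Vscale: "(\<lambda>x. c * f x) \<in> V" if "f \<in> V" for f c
    using that by (simp add: V_def L2_scale L2_inner_scale_left)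
  \<comment> \<open>The orthogonal complement of a set of eigenfunctions is invariant under a
    symmetric operator.\<close>
  have VK: "Kop f \<in> V" if f: "f \<in> V" for f
  proof -
    have "L2_inner \<mu> (Kop f) u = 0" if u: "u \<in> U" for u
    proof -
      obtain c where c: "AE x in \<mu>. Kop u x = c * u x" using Ueig[OF u] by blast
      have uL: "u \<in> L2 \<mu>" using u U by blast
      have "L2_inner \<mu> (Kop f) u = L2_inner \<mu> (Kop u) f"
        using Kop_symmetric[OF VL2[OF f] uL] by (simp add: L2_inner_commute)
      also have "\<dots> = L2_inner \<mu> (\<lambda>x. c * u x) f"
        by (rule L2_inner_cong) (use uL VL2[OF f] c in \<open>simp_all add: L2_measurable Kop_L2 L2_scale\<close>)
      also have "\<dots> = 0"
        using f u by (simp add: V_def L2_inner_scale_left L2_inner_commute[of \<mu> u])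
      finally show ?thesis .
    qed
    then show ?thesis by (simp add: V_def Kop_L2[OF VL2[OF f]])
  qed
  have Kle: "\<bar>Kop f x\<bar> \<le> \<bar>W * w x\<bar>" if "f \<in> V" "L2_inner \<mu> f f \<le> 1" for f x
  proof -
    have W0: "W \<ge> 0" by (simp add: W_def L2_inner_self_nonneg)
    have "\<bar>Kop f x\<bar> \<le> w x * (W * sqrt (L2_inner \<mu> f f))"
      unfolding W_def by (rule Kop_bound[OF VL2[OF that(1)]])
    also have "\<dots> \<le> w x * (W * 1)"
      by (intro mult_left_mono) (use that(2) W0 w_nonneg in auto)
    finally show ?thesis by (simp add: mult.commute)
  qed
  have Sb: "bdd_above S"
  proof (rule bdd_aboveI)
    fix s assume "s \<in> S"
    then obtain f where f: "s = L2_inner \<mu> (Kop f) (Kop f)" "f \<in> V" "L2_inner \<mu> f f \<le> 1"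
      by (auto simp: S_def)
    show "s \<le> L2_inner \<mu> (\<lambda>x. W * w x) (\<lambda>x. W * w x)"
      unfolding f(1) L2_inner_def
    proof (rule integral_mono)
      show "Kop f x * Kop f x \<le> W * w x * (W * w x)" for x
        using mult_mono[OF Kle[OF f(2,3)] Kle[OF f(2,3)], of x x] by (simp flip: abs_mult)
    qed (intro L2_mult_integrable Kop_L2 VL2 f L2_scale w_L2)+
  qed
  have K0: "L2_inner \<mu> (Kop f) (Kop f) = 0" if "f \<in> L2 \<mu>" "L2_inner \<mu> f f = 0" for f
  proof -
    have "Kop f x = 0" for x using Kop_bound[OF that(1), of x] by (simp add: that(2))
    then show ?thesis by (simp add: L2_inner_def)
  qed
  \<comment> \<open>Homogeneity extends the bound from the unit ball to all of \<open>V\<close>;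
    elements of norm zero cannot be normalised and are handled by \<open>K0\<close>.\<close>
  have N_le: "L2_inner \<mu> (Kop f) (Kop f) \<le> N * L2_inner \<mu> f f" if f: "f \<in> V" for f
  proof (cases "L2_inner \<mu> f f = 0")
    case True
    then show ?thesis using K0[OF VL2[OF f]] by simp
  next
    case False
    then have pos: "L2_inner \<mu> f f > 0" using L2_inner_self_nonneg[of \<mu> f] by simp
    define a where "a = 1 / sqrt (L2_inner \<mu> f f)"
    have a2: "a * a = 1 / L2_inner \<mu> f f" using pos by (simp add: a_def)
    have Ka: "Kop (\<lambda>x. a * f x) = (\<lambda>x. a * Kop f x)" by (simp add: Kop_scale fun_eq_iff)
    have "L2_inner \<mu> (Kop (\<lambda>x. a * f x)) (Kop (\<lambda>x. a * f x)) \<le> N"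
      unfolding N_def
    proof (rule cSup_upper[OF _ Sb])
      have "L2_inner \<mu> (\<lambda>x. a * f x) (\<lambda>x. a * f x) = 1"
        using pos a2 by (simp add: L2_inner_scale_left L2_inner_scale_right flip: mult.assoc)
      then show "L2_inner \<mu> (Kop (\<lambda>x. a * f x)) (Kop (\<lambda>x. a * f x)) \<in> S"
        unfolding S_def using Vscale[OF f, of a] by force
    qed
    then have "(a * a) * L2_inner \<mu> (Kop f) (Kop f) \<le> N"
      by (simp add: Ka L2_inner_scale_left L2_inner_scale_right mult.assoc)
    then show ?thesis unfolding a2 using pos by (simp add: field_simps)
  qed
  have f0V: "f0 \<in> V" using f0 f0U by (simp add: V_def)
  have N_pos: "N > 0"
  proof -
    have "0 < L2_inner \<mu> (Kop f0) (Kop f0)" using f0K L2_inner_self_nonneg[of \<mu> "Kop f0"] by simp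
    also have "\<dots> \<le> N * L2_inner \<mu> f0 f0" by (rule N_le[OF f0V])
    finally show ?thesis
      using L2_inner_self_nonneg[of \<mu> f0] by (simp add: zero_less_mult_iff)
  qed
  have Sne: "S \<noteq> {}"
  proof -
    have "(\<lambda>x. 0) \<in> V" by (simp add: V_def L2_zero) (simp add: L2_inner_def)
    then show ?thesis unfolding S_def by (auto simp: L2_inner_def intro!: exI[of _ "\<lambda>x. 0"])
  qed
  have "\<exists>f. f \<in> V \<and> L2_inner \<mu> f f \<le> 1 \<and> N - 1 / real (Suc n) < L2_inner \<mu> (Kop f) (Kop f)" for n
    using less_cSup_iff[OF Sne Sb, of "N - 1 / real (Suc n)"] by (auto simp: N_def S_def)
  then obtain f where f: "\<And>n. f n \<in> V" "\<And>n. L2_inner \<mu> (f n) (f n) \<le> 1"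
    "\<And>n. N - 1 / real (Suc n) < L2_inner \<mu> (Kop (f n)) (Kop (f n))"
    by metis
  have fL: "f n \<in> L2 \<mu>" for n using f(1) by (rule VL2)
  obtain r :: "nat \<Rightarrow> nat" and g where r: "strict_mono r" and g: "\<forall>x. (\<lambda>n. Kop (f (r n)) x) \<longlonglongrightarrow> g x"
    by (rule Kop_compact[of f, OF fL f(2)])
  define h where "h n = Kop (f (r n))" for n
  have hg: "(\<lambda>n. h n x) \<longlonglongrightarrow> g x" for x using g by (simp add: h_def)
  have hV: "h n \<in> V" for n by (simp add: h_def VK f)
  have hL: "h n \<in> L2 \<mu>" for n using hV by (rule VL2)
  have hm: "h n \<in> borel_measurable \<mu>" for n by (rule L2_measurable[OF hL])
  have hb: "\<bar>h n x\<bar> \<le> \<bar>W * w x\<bar>" for n x unfolding h_def by (rule Kle[OF f(1,2)])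
  have WL: "(\<lambda>x. W * w x) \<in> L2 \<mu>" by (rule L2_scale[OF w_L2])
  have gL: "g \<in> L2 \<mu>" by (rule L2_dominated_limit[OF hm WL hg hb])
  have gm: "g \<in> borel_measurable \<mu>" by (rule L2_measurable[OF gL])
  have hh: "(\<lambda>n. L2_inner \<mu> (h n) (h n)) \<longlonglongrightarrow> L2_inner \<mu> g g"
    by (rule L2_inner_tendsto[OF hm gm hm gm WL WL hg hg hb hb])
  have hhN: "(\<lambda>n. L2_inner \<mu> (h n) (h n)) \<longlonglongrightarrow> N"
  proof (rule tendsto_sandwich[of "\<lambda>n. N - 1 / real (Suc (r n))" _ _ "\<lambda>n. N"])
    have "(\<lambda>n. N - 1 / real (Suc n)) \<longlonglongrightarrow> N - 0"
      by (intro tendsto_diff tendsto_const LIMSEQ_Suc[OF lim_1_over_n, unfolded of_nat_Suc[symmetric]]) 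
    then show "(\<lambda>n. N - 1 / real (Suc (r n))) \<longlonglongrightarrow> N"
      using LIMSEQ_subseq_LIMSEQ[OF _ r] by (fastforce simp: o_def)
    have "L2_inner \<mu> (h n) (h n) \<le> N" for n
      unfolding N_def by (rule cSup_upper[OF _ Sb]) (use f h_def S_def in auto)
    then show "\<forall>\<^sub>F n in sequentially. L2_inner \<mu> (h n) (h n) \<le> N" by simp
    show "\<forall>\<^sub>F n in sequentially. N - 1 / real (Suc (r n)) \<le> L2_inner \<mu> (h n) (h n)"
      using f(3) by (simp add: h_def less_imp_le)
  qed simp
  have ggN: "L2_inner \<mu> g g = N" by (rule LIMSEQ_unique[OF hh hhN])
  have gU: "\<forall>u\<in>U. L2_inner \<mu> g u = 0"
  proof
    fix u assume u: "u \<in> U"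
    have uL: "u \<in> L2 \<mu>" using u U by blast
    have "(\<lambda>n. L2_inner \<mu> (h n) u) \<longlonglongrightarrow> L2_inner \<mu> g u"
      by (rule L2_inner_tendsto[OF hm gm L2_measurable[OF uL] L2_measurable[OF uL] WL uL hg tendsto_const hb order_refl])
    moreover have "L2_inner \<mu> (h n) u = 0" for n using hV[of n] u by (simp add: V_def)
    ultimately show "L2_inner \<mu> g u = 0" by (simp add: LIMSEQ_const_iff)
  qed
  define q where "q n = (\<lambda>x. Kop (h n) x - N * f (r n) x)" for n
  have qL: "q n \<in> L2 \<mu>" for n
    unfolding q_def by (intro L2_diff L2_scale Kop_L2 hL fL)
  \<comment> \<open>Expand the square and use symmetry for the cross term. Along the maximising
    sequence the bound tends to 0, so the \<open>f (r n)\<close> are approximate eigenfunctions of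
    the square of \<open>Kop\<close> for \<open>N\<close>.\<close>
  have q_le: "L2_inner \<mu> (q n) (q n) \<le> N * (N - L2_inner \<mu> (h n) (h n))" for n
  proof -
    have cross: "L2_inner \<mu> (Kop (h n)) (f (r n)) = L2_inner \<mu> (h n) (h n)"
      using Kop_symmetric[OF hL fL] by (simp add: h_def)
    have "L2_inner \<mu> (q n) (q n) = L2_inner \<mu> (Kop (h n)) (Kop (h n))
        - 2 * N * L2_inner \<mu> (h n) (h n) + N * (N * L2_inner \<mu> (f (r n)) (f (r n)))"
      unfolding q_def
      by (simp add: L2_inner_diff_left L2_inner_diff_right L2_inner_scale_left L2_inner_scale_right
          L2_diff L2_scale Kop_L2 hL fL cross L2_inner_commute[of \<mu> "f (r n)" "Kop (h n)"]
          right_diff_distrib)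
    moreover have "L2_inner \<mu> (Kop (h n)) (Kop (h n)) \<le> N * L2_inner \<mu> (h n) (h n)"
      by (rule N_le[OF hV])
    moreover have "N * (N * L2_inner \<mu> (f (r n)) (f (r n))) \<le> N * (N * 1)"
      using N_pos f(2) by (intro mult_left_mono) auto
    ultimately show ?thesis by (simp add: algebra_simps)
  qed
  have "(\<lambda>n. L2_inner \<mu> (q n) (q n)) \<longlonglongrightarrow> 0"
  proof (rule tendsto_sandwich[of "\<lambda>n. 0" _ _ "\<lambda>n. N * (N - L2_inner \<mu> (h n) (h n))"])
    have "(\<lambda>n. N * (N - L2_inner \<mu> (h n) (h n))) \<longlonglongrightarrow> N * (N - N)"
      by (intro tendsto_intros hhN)
    then show "(\<lambda>n. N * (N - L2_inner \<mu> (h n) (h n))) \<longlonglongrightarrow> 0" by simp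
  qed (simp_all add: L2_inner_self_nonneg q_le)
  then have q0: "(\<lambda>n. sqrt (L2_inner \<mu> (q n) (q n))) \<longlonglongrightarrow> 0"
    using tendsto_real_sqrt by fastforce
  \<comment> \<open>One more application of \<open>Kop\<close> turns norm convergence of
    \<open>q n\<close> to 0 into pointwise convergence, and \<open>Kop (q n)\<close> involves only
    the pointwise convergent \<open>h n\<close>.\<close>
  have KKg: "Kop (Kop g) x = N * g x" for x
  proof -
    have Kq: "(\<lambda>n. Kop (q n) x) \<longlonglongrightarrow> 0"
    proof (rule Lim_null_comparison)
      show "\<forall>\<^sub>F n in sequentially. norm (Kop (q n) x) \<le> w x * (W * sqrt (L2_inner \<mu> (q n) (q n)))"
        using Kop_bound[OF qL] by (simp add: W_def)
      show "(\<lambda>n. w x * (W * sqrt (L2_inner \<mu> (q n) (q n)))) \<longlonglongrightarrow> 0"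
        using tendsto_mult_right_zero[OF tendsto_mult_right_zero[OF q0]] by fastforce
    qed
    have Kh: "(\<lambda>n. Kop (h n) y) \<longlonglongrightarrow> Kop g y" for y
      by (rule Kop_pointwise_tendsto[OF hm WL hg hb])
    have hn: "L2_inner \<mu> (h n) (h n) \<le> N" for n
      unfolding N_def by (rule cSup_upper[OF _ Sb]) (use f h_def S_def in auto)
    have W0: "W \<ge> 0" by (simp add: W_def L2_inner_self_nonneg)
    have Khb: "\<bar>Kop (h n) y\<bar> \<le> \<bar>(W * sqrt N) * w y\<bar>" for n y
    proof -
      have "\<bar>Kop (h n) y\<bar> \<le> w y * (W * sqrt (L2_inner \<mu> (h n) (h n)))"
        unfolding W_def by (rule Kop_bound[OF hL])
      also have "\<dots> \<le> w y * (W * sqrt N)"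
        by (intro mult_left_mono) (use hn W0 w_nonneg in auto)
      finally show ?thesis by (simp add: mult_ac)
    qed
    have "(\<lambda>n. Kop (Kop (h n)) x) \<longlonglongrightarrow> Kop (Kop g) x"
      by (rule Kop_pointwise_tendsto[OF L2_measurable[OF Kop_L2[OF hL]] L2_scale[OF w_L2] Kh Khb])
    then have "(\<lambda>n. Kop (Kop (h n)) x - N * h n x) \<longlonglongrightarrow> Kop (Kop g) x - N * g x"
      by (intro tendsto_intros hg)
    moreover have "Kop (Kop (h n)) x - N * h n x = Kop (q n) x" for n
      unfolding q_def by (simp add: Kop_diff Kop_scale Kop_L2 hL L2_scale fL) (simp add: h_def)
    ultimately have "Kop (Kop g) x - N * g x = 0" using Kq LIMSEQ_unique by fastforce
    then show ?thesis by simp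
  qed
  define c where "c = sqrt N"
  have c: "c > 0" "c * c = N" using N_pos by (simp_all add: c_def)
  \<comment> \<open>As the square of \<open>Kop\<close> multiplies \<open>g\<close> by
    \<open>c * c\<close>, the operator \<open>Kop - c\<close> annihilates
    \<open>(Kop + c) g\<close>. If this vector is null, \<open>g\<close> itself is an eigenfunction
    for \<open>- c\<close>.\<close>
  define v where "v = (\<lambda>x. Kop g x + c * g x)"
  have vL: "v \<in> L2 \<mu>" unfolding v_def by (intro L2_add L2_scale Kop_L2 gL)
  have gV: "g \<in> V" using gL gU by (simp add: V_def)
  have vU: "\<forall>u\<in>U. L2_inner \<mu> v u = 0"
  proof
    fix u assume u: "u \<in> U"
    then have "u \<in> L2 \<mu>" using U by blast
    then show "L2_inner \<mu> v u = 0"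
      using VK[OF gV] gU u
      by (simp add: v_def L2_inner_add_left L2_inner_scale_left L2_scale gL Kop_L2 V_def)
  qed
  have Kv: "Kop v x = c * v x" for x
    unfolding v_def
    by (simp add: Kop_add Kop_scale KKg Kop_L2 gL L2_scale distrib_left c(2) flip: mult.assoc)
  show thesis
  proof (cases "L2_inner \<mu> v v = 0")
    case False
    then show ?thesis using that[OF vL vU, of c] c Kv by simp
  next
    case True
    then have "AE x in \<mu>. v x = 0" using vL by (simp add: L2_inner_self_eq_0)
    then have "AE x in \<mu>. Kop g x = (- c) * g x"
      by eventually_elim (simp add: v_def)
    then show ?thesis using that[OF gL gU, of "- c"] c ggN N_pos by simp
  qed
qed

end

section \<open>The doubly centred kernel of a measure with finite fourth moment\<close>

text \<open>The distance is the infimum of \<open>dist x z + dist y z\<close> over the countable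
  dense set, and each of these functions is measurable for the product sigma-algebra. A detour
  through \<open>z\<close> costs at most \<open>2 * dist x z\<close>.\<close>

lemma dist_pair_measurable:
  fixes D :: "'a::metric_space set" and M :: "'a measure"
  assumes D: "countable D" "closure D = UNIV" and M: "sets M = sets borel"
  shows "(\<lambda>(x, y). dist x y) \<in> borel_measurable (M \<Otimes>\<^sub>M M)"
proof -
  have [measurable]: "(\<lambda>x. dist x z) \<in> borel_measurable M" for z
    using M borel_measurable_continuous_onI[of "\<lambda>x. dist x z"]
    by (simp add: continuous_on_dist cong: measurable_cong_sets)
  have D0: "D \<noteq> {}" using D(2) by auto
  have eq: "dist x y = (INF z\<in>D. dist x z + dist y z)" for x y
  proof (rule antisym)
    show "dist x y \<le> (INF z\<in>D. dist x z + dist y z)"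
      using D0 by (intro cINF_greatest) (auto simp: dist_triangle2)
    show "(INF z\<in>D. dist x z + dist y z) \<le> dist x y"
    proof (rule field_le_epsilon)
      fix e :: real assume "0 < e"
      moreover have "x \<in> closure D" by (simp add: D(2))
      ultimately obtain z where z: "z \<in> D" "dist z x < e / 2"
        unfolding closure_approachable by (meson half_gt_zero)
      have "(INF z\<in>D. dist x z + dist y z) \<le> dist x z + dist y z"
        by (rule cINF_lower[OF _ z(1)]) (auto intro!: bdd_belowI[of _ 0])
      also have "\<dots> \<le> dist x y + e"
        using z(2) dist_triangle[of y z x] by (simp add: dist_commute)
      finally show "(INF z\<in>D. dist x z + dist y z) \<le> dist x y + e" .
    qed
  qed
  have "(\<lambda>p. INF z\<in>D. dist (fst p) z + dist (snd p) z) \<in> borel_measurable (M \<Otimes>\<^sub>M M)"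
    by (rule borel_measurable_cINF_real[OF D(1)]) measurable
  moreover have "(\<lambda>(x, y). dist x y) = (\<lambda>p. INF z\<in>D. dist (fst p) z + dist (snd p) z)"
    by (intro ext) (simp add: case_prod_beta eq[symmetric])
  ultimately show ?thesis by simp
qed

text \<open>The set where \<open>f\<close> and \<open>g\<close> differ is open and null, whereas
  full support gives every nonempty open set positive measure.\<close>

lemma continuous_eq_if_AE_eq:
  fixes f g :: "'a::topological_space \<Rightarrow> real"
  assumes "supp \<mu> = UNIV" and sets: "sets \<mu> = sets borel"
    and f: "continuous_on UNIV f" and g: "continuous_on UNIV g" and ae: "AE x in \<mu>. f x = g x"
  shows "f x = g x"
proof (rule ccontr)
  assume "f x \<noteq> g x"
  have "open {x. f x \<noteq> g x}"
    using f g by (rule open_Collect_neq)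
  moreover have "x \<in> supp \<mu>" using assms(1) by simp
  ultimately have pos: "emeasure \<mu> {x. f x \<noteq> g x} > 0"
    using \<open>f x \<noteq> g x\<close> by (auto simp: supp_def)
  have "{x \<in> space \<mu>. \<not> f x = g x} = {x. f x \<noteq> g x}"
    using sets_eq_imp_space_eq[OF sets] by auto
  then have "emeasure \<mu> {x. f x \<noteq> g x} = 0"
    using AE_iff_measurable[of "{x. f x \<noteq> g x}" \<mu> "\<lambda>x. f x = g x"] ae \<open>open {x. f x \<noteq> g x}\<close>
    by (simp add: sets)
  with pos show False by simp
qed

lemma orthogonal_imp_L2_independent:
  assumes S: "finite S" "S \<subseteq> L2 \<mu>"
    and orth: "\<And>u v. u \<in> S \<Longrightarrow> v \<in> S \<Longrightarrow> u \<noteq> v \<Longrightarrow> L2_inner \<mu> u v = 0"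
    and ne: "\<And>u. u \<in> S \<Longrightarrow> L2_inner \<mu> u u \<noteq> 0"
  shows "L2_independent \<mu> S"
  unfolding L2_independent_def
proof (intro allI impI ballI)
  fix c v assume ae: "AE x in \<mu>. (\<Sum>u\<in>S. c u * u x) = 0" and v: "v \<in> S"
  have SL: "u \<in> L2 \<mu>" if "u \<in> S" for u using that S by blast
  let ?s = "\<lambda>x. \<Sum>u\<in>S. c u * u x"
  have sL: "?s \<in> L2 \<mu>" by (intro L2_sum L2_scale SL)
  have "L2_inner \<mu> ?s v = L2_inner \<mu> (\<lambda>x. 0) v"
    by (rule L2_inner_cong[OF _ _ _ ae]) (use L2_measurable sL SL v in auto)
  then have "0 = L2_inner \<mu> ?s v" by (simp add: L2_inner_def)
  also have "\<dots> = (\<Sum>u\<in>S. c u * L2_inner \<mu> u v)"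
    by (simp add: L2_inner_sum_left L2_scale SL v L2_inner_scale_left)
  also have "\<dots> = (\<Sum>u\<in>S. if u = v then c v * L2_inner \<mu> v v else 0)"
    by (rule sum.cong) (use orth v in auto)
  also have "\<dots> = c v * L2_inner \<mu> v v" using S v by simp
  finally show "c v = 0" using ne[OF v] by simp
qed

section \<open>Measures with finite fourth moment and their two kernels\<close>

locale fourth_moment_measure = prob_space \<mu> for \<mu> :: "'a::metric_space measure" +
  fixes x0 :: 'a and D :: "'a set"
  assumes sets_eq: "sets \<mu> = sets borel"
    and countable_D: "countable D" and dense_D: "closure D = UNIV"
    and moment: "integrable \<mu> (\<lambda>y. dist x0 y ^ 4)"
begin

text \<open>The finite fourth moment says precisely that this function is square-integrable.\<close>

definition sq_dist :: "'a \<Rightarrow> real" where "sq_dist x = (dist x0 x)\<^sup>2"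

lemma sq_dist_continuous: "continuous_on UNIV sq_dist"
  unfolding sq_dist_def by (intro continuous_intros)

lemma sq_dist_L2: "sq_dist \<in> L2 \<mu>"
  using moment borel_measurable_continuous_onI[OF sq_dist_continuous] sets_eq
  by (simp add: L2_def sq_dist_def[abs_def] power_mult[symmetric] cong: measurable_cong_sets)

lemma sq_dist_nonneg: "0 \<le> sq_dist x"
  by (simp add: sq_dist_def)

lemma kern_bound: "\<bar>kern x y\<bar> \<le> sq_dist x + sq_dist y"
proof -
  have "(dist x y)\<^sup>2 \<le> (dist x0 x + dist x0 y)\<^sup>2"
    by (intro power_mono dist_triangle3) simp
  also have "\<dots> \<le> 2 * (sq_dist x + sq_dist y)"
    using sum_squares_ge_zero[of "dist x0 x - dist x0 y" 0]
    by (simp add: sq_dist_def power2_eq_square algebra_simps)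
  finally show ?thesis by (simp add: kern_def abs_mult)
qed

lemma kern_commute: "kern x y = kern y x"
  by (simp add: kern_def dist_commute)

text \<open>The summand 1 in the weight turns the additive bound
  \<open>sq_dist x + sq_dist y\<close> into a product bound.\<close>

sublocale K: dominated_kernel \<mu> kern "\<lambda>x. 1 + sq_dist x" D
proof
  show "(\<lambda>(x, y). kern x y) \<in> borel_measurable (\<mu> \<Otimes>\<^sub>M \<mu>)"
  proof -
    note [measurable] = dist_pair_measurable[OF countable_D dense_D sets_eq]
    have "(\<lambda>p. - (1/2) * ((\<lambda>(x, y). dist x y) p)\<^sup>2) \<in> borel_measurable (\<mu> \<Otimes>\<^sub>M \<mu>)"
      by measurable
    then show ?thesis by (simp add: kern_def case_prod_beta')
  qed
  show "continuous_on UNIV (kern x)" for x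
    unfolding kern_def[abs_def] by (intro continuous_intros)
  show "\<bar>kern x y\<bar> \<le> (1 + sq_dist x) * (1 + sq_dist y)" for x y
  proof -
    have "0 \<le> sq_dist x * sq_dist y" by (simp add: sq_dist_nonneg)
    then show ?thesis using kern_bound[of x y] by (simp add: algebra_simps)
  qed
qed (auto intro!: continuous_intros L2_add L2_const sq_dist_L2 sq_dist_continuous
      simp: sets_eq countable_D dense_D sq_dist_nonneg kern_commute)

lemma K_op_eq: "K_op \<mu> u = K.Kop u"
  by (auto simp: K_op_def K.Kop_def L2_inner_def kern_def fun_eq_iff mult.assoc)

definition row_mean :: "'a \<Rightarrow> real" where "row_mean = K.Kop (\<lambda>_. 1)"

lemma row_mean_L2: "row_mean \<in> L2 \<mu>"
  unfolding row_mean_def by (intro K.Kop_L2 L2_const)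

lemma row_mean_continuous: "continuous_on UNIV row_mean"
  unfolding row_mean_def by (intro K.Kop_continuous L2_const)

lemma kern_T_eq: "kern_T \<mu> x y = kern x y - row_mean x - row_mean y + L2_inner \<mu> row_mean (\<lambda>_. 1)"
  by (simp add: kern_T_def row_mean_def K.Kop_def L2_inner_def kern_commute[of _ y])

lemma kern_T_refl_diff: "kern_T \<mu> x x + kern_T \<mu> y y - 2 * kern_T \<mu> x y = (dist x y)\<^sup>2"
  by (simp add: kern_T_eq) (simp add: kern_def)

text \<open>The terms of the double centring are bounded additively; as for \<open>kern\<close>, the
  leading 1 makes the product of weights exceed their sum.\<close>

definition weight :: "'a \<Rightarrow> real" where
  "weight x = 1 + sq_dist x + \<bar>row_mean x\<bar> + \<bar>L2_inner \<mu> row_mean (\<lambda>_. 1)\<bar>"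

sublocale T: dominated_kernel \<mu> "kern_T \<mu>" weight D
proof
  show "(\<lambda>(x, y). kern_T \<mu> x y) \<in> borel_measurable (\<mu> \<Otimes>\<^sub>M \<mu>)"
  proof -
    note [measurable] = K.k_pair_measurable L2_measurable[OF row_mean_L2]
    have "(\<lambda>p. (\<lambda>(x, y). kern x y) p - row_mean (fst p) - row_mean (snd p) + L2_inner \<mu> row_mean (\<lambda>_. 1))
        \<in> borel_measurable (\<mu> \<Otimes>\<^sub>M \<mu>)"
      by measurable
    then show ?thesis by (simp add: kern_T_eq case_prod_beta')
  qed
  show "kern_T \<mu> x y = kern_T \<mu> y x" for x y by (simp add: kern_T_eq kern_commute)
  show "continuous_on UNIV (kern_T \<mu> x)" for x
    unfolding kern_T_eq[abs_def] by (intro continuous_intros K.cont row_mean_continuous)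
  show "continuous_on UNIV weight"
    unfolding weight_def by (intro continuous_intros row_mean_continuous sq_dist_continuous)
  show "0 \<le> weight x" for x by (simp add: weight_def sq_dist_nonneg)
  show "weight \<in> L2 \<mu>"
    unfolding weight_def by (intro L2_add L2_abs L2_const sq_dist_L2 row_mean_L2)
  show "\<bar>kern_T \<mu> x y\<bar> \<le> weight x * weight y" for x y
  proof -
    define s where "s z = sq_dist z + \<bar>row_mean z\<bar> + \<bar>L2_inner \<mu> row_mean (\<lambda>_. 1)\<bar>" for z
    have s: "0 \<le> s z" "weight z = 1 + s z" for z by (simp_all add: s_def weight_def sq_dist_nonneg)
    have "\<bar>kern_T \<mu> x y\<bar> \<le> 1 + s x + s y"
      unfolding kern_T_eq s_def using kern_bound[of x y] by linarith
    also have "\<dots> \<le> weight x * weight y"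
      using s(1)[of x] s(1)[of y] by (simp add: s(2) algebra_simps)
    finally show ?thesis .
  qed
qed (simp_all add: sets_eq countable_D dense_D)

text \<open>Expand the two projections and the centred kernel. The terms match because symmetry of
  \<open>K.Kop\<close> turns the mean of \<open>K.Kop f\<close> into the inner product of
  \<open>f\<close> with \<open>row_mean\<close>. The equality holds at every point.\<close>

lemma T_op_eq:
  assumes f: "f \<in> L2 \<mu>"
  shows "T_op \<mu> f = T.Kop f"
proof
  fix x
  define m where "m = L2_inner \<mu> f (\<lambda>_. 1)"
  define A where "A = L2_inner \<mu> row_mean (\<lambda>_. 1)"
  have 1: "(\<lambda>_. 1) \<in> L2 \<mu>" and mL: "(\<lambda>_. m) \<in> L2 \<mu>" by (rule L2_const)+
  have Km: "K.Kop (\<lambda>_. m) z = m * row_mean z" for z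
    using K.Kop_scale[of m "\<lambda>_. 1" z] by (simp add: row_mean_def)
  have KP: "K_op \<mu> (P_op \<mu> f) = (\<lambda>z. K.Kop f z - m * row_mean z)"
    unfolding K_op_eq P_op_def m_def[symmetric] mult_1_right
    by (simp add: fun_eq_iff K.Kop_diff f mL Km)
  have "T_op \<mu> f x = K.Kop f x - m * row_mean x - (L2_inner \<mu> f row_mean - m * A)"
    unfolding T_op_def KP unfolding P_op_def
    using K.Kop_symmetric[OF f 1]
    by (simp add: L2_inner_diff_left L2_inner_scale_left K.Kop_L2 f L2_scale row_mean_L2 1 flip: row_mean_def A_def)
  moreover have "T.Kop f x = K.Kop f x - row_mean x * m - L2_inner \<mu> row_mean f + A * m"
  proof -
    have row: "kern_T \<mu> x = (\<lambda>y. (kern x y - row_mean x * 1) - row_mean y + A * 1)"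
      by (simp add: fun_eq_iff kern_T_eq A_def)
    have kL: "kern x \<in> L2 \<mu>" by (rule K.row_L2)
    have aL: "(\<lambda>y. row_mean x * 1) \<in> L2 \<mu>" "(\<lambda>y. A * 1) \<in> L2 \<mu>" by (rule L2_const)+
    show ?thesis
      unfolding T.Kop_def row m_def K.Kop_def L2_inner_commute[of \<mu> f "\<lambda>_. 1"]
      by (simp only: L2_inner_add_left L2_inner_diff_left L2_inner_scale_left L2_diff kL aL row_mean_L2 f)
  qed
  ultimately show "T_op \<mu> f x = T.Kop f x"
    by (simp add: L2_inner_commute[of \<mu> row_mean f] mult.commute)
qed

lemma eigenspace_T_op: "eigenspace \<mu> (T_op \<mu>) c = {u \<in> L2 \<mu>. AE x in \<mu>. T.Kop u x = c * u x}"
  by (auto simp: eigenspace_def T_op_eq)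

section \<open>Spectral expansion of the centred kernel\<close>

text \<open>A Mercer expansion with finitely many terms. It is stated with the continuous
  representatives so that it can hold at every pair of points.\<close>

lemma kern_T_expansion:
  assumes supp: "supp \<mu> = UNIV" and sys: "nonzero_eigensystem \<mu> (T_op \<mu>) n p lam u"
  shows "kern_T \<mu> x y
    = (\<Sum>i\<in>{1..n+p}. lam i * cont_rep \<mu> (lam i) (u i) x * cont_rep \<mu> (lam i) (u i) y)"
proof -
  let ?I = "{1..n+p}"
  have neg: "lam i < 0" if "i \<in> {1..n}" for i
    using sys that unfolding nonzero_eigensystem_def by blast
  have pos: "lam i > 0" if "i \<in> {n+1..n+p}" for i
    using sys that unfolding nonzero_eigensystem_def by blast
  have lam0: "lam i \<noteq> 0" if "i \<in> ?I" for i
    using neg[of i] pos[of i] that by (cases "i \<le> n") auto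
  have mult: "enat (card {i\<in>?I. lam i = c}) = eigen_mult \<mu> (T_op \<mu>) c" if "c \<noteq> 0" for c
    using sys that unfolding nonzero_eigensystem_def by blast
  have uE: "u i \<in> eigenspace \<mu> (T_op \<mu>) (lam i)" if "i \<in> ?I" for i
    using sys that unfolding nonzero_eigensystem_def by blast
  have uL: "u i \<in> L2 \<mu>" and uK: "AE x in \<mu>. T.Kop (u i) x = lam i * u i x" if "i \<in> ?I" for i
    using uE[OF that] by (auto simp: eigenspace_T_op)
  have orth: "L2_inner \<mu> (u i) (u j) = (if i = j then 1 else 0)" if "i \<in> ?I" "j \<in> ?I" for i j
    using sys that unfolding nonzero_eigensystem_def by blast
  have K_orth: "L2_inner \<mu> (T.Kop f) (T.Kop f) = 0"
    if f: "f \<in> L2 \<mu>" and fu: "\<And>i. i \<in> ?I \<Longrightarrow> L2_inner \<mu> f (u i) = 0" for f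
  proof (rule ccontr)
    assume nz: "L2_inner \<mu> (T.Kop f) (T.Kop f) \<noteq> 0"
    have 1: "u ` ?I \<subseteq> L2 \<mu>" using uL by blast
    have 2: "\<exists>c. AE x in \<mu>. T.Kop v x = c * v x" if "v \<in> u ` ?I" for v
      using that uK by blast
    have 3: "L2_inner \<mu> f v = 0" if "v \<in> u ` ?I" for v using that fu by blast
    obtain v c where v: "v \<in> L2 \<mu>" "\<forall>z\<in>u ` ?I. L2_inner \<mu> v z = 0" "c \<noteq> 0"
        "AE x in \<mu>. T.Kop v x = c * v x" "L2_inner \<mu> v v \<noteq> 0"
      using T.exists_eigenfunction_orthogonal[OF 1 2 f 3 nz] by blast
    \<comment> \<open>Adjoining \<open>v\<close> to the listed eigenfunctions for \<open>c\<close>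
      exceeds the multiplicity recorded by the system. \<open>J\<close> may be empty: then
      \<open>c\<close> should have multiplicity 0.\<close>
    define J where "J = {i\<in>?I. lam i = c}"
    define S where "S = insert v (u ` J)"
    have inj: "inj_on u J"
    proof (rule inj_onI)
      fix i j assume ij: "i \<in> J" "j \<in> J" "u i = u j"
      then have "L2_inner \<mu> (u i) (u j) = 1" using orth[of i i] by (simp add: J_def)
      then show "i = j" using orth[of i j] ij by (simp add: J_def split: if_splits)
    qed
    have vn: "v \<notin> u ` J" using v(2,5) by (auto simp: J_def)
    have finJ: "finite J" by (simp add: J_def)
    have card: "card S = Suc (card J)"
      using vn finJ by (simp add: S_def card_image[OF inj])
    have "S \<subseteq> eigenspace \<mu> (T_op \<mu>) c"
    proof -
      have "v \<in> eigenspace \<mu> (T_op \<mu>) c" using v(1,4) by (simp add: eigenspace_T_op)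
      moreover have "u ` J \<subseteq> eigenspace \<mu> (T_op \<mu>) c" using uE by (auto simp: J_def)
      ultimately show ?thesis by (simp add: S_def)
    qed
    moreover have "L2_independent \<mu> S"
    proof (rule orthogonal_imp_L2_independent)
      show "finite S" using finJ by (simp add: S_def)
      show "S \<subseteq> L2 \<mu>" using v(1) uL by (auto simp: S_def J_def)
      fix z assume z: "z \<in> S"
      show "L2_inner \<mu> z z \<noteq> 0" using z v(5) orth by (auto simp: S_def J_def)
      fix z' assume z': "z' \<in> S" "z \<noteq> z'"
      show "L2_inner \<mu> z z' = 0"
      proof (cases "z = v \<or> z' = v")
        case True
        then show ?thesis using z z' v(2) L2_inner_commute[of \<mu> z z'] by (auto simp: S_def J_def)
      next
        case False
        then show ?thesis using z z' orth by (auto simp: S_def J_def)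
      qed
    qed
    ultimately have "enat (card S) \<le> eigen_mult \<mu> (T_op \<mu>) c"
      unfolding eigen_mult_def using finJ by (intro SUP_upper) (auto simp: S_def)
    then have "enat (card S) \<le> enat (card J)" by (simp only: mult[OF v(3), symmetric] J_def)
    then show False using card by simp
  qed
  define b where "b i = T.Kop (u i)" for i
  have rep: "cont_rep \<mu> (lam i) (u i) z = inverse (lam i) * b i z" for i z
    by (simp add: cont_rep_def b_def T.Kop_def L2_inner_def)
  have b_cont: "continuous_on UNIV (b i)" if "i \<in> ?I" for i
    unfolding b_def by (rule T.Kop_continuous[OF uL[OF that]])
  \<comment> \<open>The coefficient \<open>b i x\<close> is the inner product of
    \<open>kern_T \<mu> x\<close> with \<open>u i\<close>, so \<open>R\<close> is the row minus its
    projection onto the span of the \<open>u i\<close>.\<close>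
  define R where "R = (\<lambda>z. kern_T \<mu> x z - (\<Sum>i\<in>?I. b i x * u i z))"
  have sL: "(\<lambda>z. \<Sum>i\<in>?I. b i x * u i z) \<in> L2 \<mu>" by (intro L2_sum L2_scale uL)
  have RL: "R \<in> L2 \<mu>" unfolding R_def by (intro L2_diff T.row_L2 sL)
  have R_inner: "L2_inner \<mu> R g = L2_inner \<mu> (kern_T \<mu> x) g - (\<Sum>i\<in>?I. b i x * L2_inner \<mu> (u i) g)"
    if g: "g \<in> L2 \<mu>" for g
  proof -
    have "L2_inner \<mu> (\<lambda>z. \<Sum>i\<in>?I. b i x * u i z) g = (\<Sum>i\<in>?I. L2_inner \<mu> (\<lambda>z. b i x * u i z) g)"
      by (rule L2_inner_sum_left) (intro L2_scale uL g, assumption, rule g)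
    then show ?thesis
      unfolding R_def L2_inner_diff_left[OF T.row_L2 sL g] by (simp only: L2_inner_scale_left)
  qed
  have Ru: "L2_inner \<mu> R (u j) = 0" if j: "j \<in> ?I" for j
  proof -
    have "L2_inner \<mu> R (u j) = b j x - (\<Sum>i\<in>?I. b i x * L2_inner \<mu> (u i) (u j))"
      by (simp only: R_inner[OF uL[OF j]] b_def T.Kop_def)
    also have "(\<Sum>i\<in>?I. b i x * L2_inner \<mu> (u i) (u j)) = (\<Sum>i\<in>?I. if i = j then b j x else 0)"
      by (rule sum.cong) (use orth j in auto)
    also have "\<dots> = b j x" using j by simp
    finally show ?thesis by simp
  qed
  have "AE z in \<mu>. T.Kop R z = 0"
    using K_orth[OF RL Ru] L2_inner_self_eq_0[OF T.Kop_L2[OF RL]] by simp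
  \<comment> \<open>The image of \<open>R\<close> vanishes almost everywhere; continuity and full
    support give the value at the one point \<open>x\<close> that matters.\<close>
  then have "T.Kop R x = 0"
    using continuous_eq_if_AE_eq[OF supp sets_eq T.Kop_continuous[OF RL] continuous_on_const] by blast
  \<comment> \<open>The value at \<open>x\<close> is the inner product of the row with
    \<open>R\<close>, and the part of the row removed in \<open>R\<close> is orthogonal to
    \<open>R\<close>.\<close>
  moreover have "T.Kop R x = L2_inner \<mu> R R"
  proof -
    have "L2_inner \<mu> R R = L2_inner \<mu> (kern_T \<mu> x) R - (\<Sum>i\<in>?I. b i x * L2_inner \<mu> (u i) R)"
      by (rule R_inner[OF RL])
    also have "(\<Sum>i\<in>?I. b i x * L2_inner \<mu> (u i) R) = 0"
      by (rule sum.neutral) (simp add: Ru L2_inner_commute[of \<mu> _ R])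
    finally show ?thesis by (simp add: T.Kop_def)
  qed
  ultimately have R0: "AE z in \<mu>. R z = 0"
    using L2_inner_self_eq_0[OF RL] by simp
  have "AE z in \<mu>. \<forall>i\<in>?I. b i z = lam i * u i z"
    by (rule AE_finite_allI) (use uK in \<open>auto simp: b_def\<close>)
  with R0 have "AE z in \<mu>. kern_T \<mu> x z = (\<Sum>i\<in>?I. inverse (lam i) * b i x * b i z)"
  proof eventually_elim
    case (elim z)
    have "(\<Sum>i\<in>?I. inverse (lam i) * b i x * b i z) = (\<Sum>i\<in>?I. b i x * u i z)"
      by (rule sum.cong) (use elim(2) lam0 in auto)
    with elim(1) show ?case by (simp add: R_def)
  qed
  \<comment> \<open>Both sides are continuous in the second variable, so full support upgrades the
    almost everywhere identity.\<close>
  then have "kern_T \<mu> x y = (\<Sum>i\<in>?I. inverse (lam i) * b i x * b i y)"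
    by (rule continuous_eq_if_AE_eq[OF supp sets_eq T.cont, rotated])
      (intro continuous_intros b_cont)
  also have "\<dots> = (\<Sum>i\<in>?I. lam i * cont_rep \<mu> (lam i) (u i) x * cont_rep \<mu> (lam i) (u i) y)"
    by (rule sum.cong) (use lam0 in \<open>auto simp: rep\<close>)
  finally show ?thesis .
qed

end

section \<open>Isometries into pseudo-Euclidean spaces\<close>

text \<open>The diagonal of the Gram matrix of \<open>pe_form\<close>, which merges the negative and
  positive blocks into a single sum.\<close>

definition signature_sign :: "nat \<Rightarrow> nat \<Rightarrow> real" where
  "signature_sign n i = (if i \<le> n then - 1 else 1)"

lemma pe_form_signed_sum:
  "pe_form n p u v = (\<Sum>i\<in>{1..n+p}. signature_sign n i * u i * v i)"
proof -
  have "{1..n+p} = {1..n} \<union> {n+1..n+p}" by auto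
  then have "(\<Sum>i\<in>{1..n+p}. signature_sign n i * u i * v i)
      = (\<Sum>i=1..n. signature_sign n i * u i * v i) + (\<Sum>i=n+1..n+p. signature_sign n i * u i * v i)"
    by (simp add: sum.union_disjoint)
  also have "\<dots> = (\<Sum>i=1..n. - (u i * v i)) + (\<Sum>i=n+1..n+p. u i * v i)"
    by (intro arg_cong2[where f = "(+)"] sum.cong) (auto simp: signature_sign_def)
  finally show ?thesis by (simp add: pe_form_def sum_negf)
qed

text \<open>The cone condition comes from the form being a square on differences; nonnegativity of
  \<open>d\<close> recovers it from the root.\<close>

lemma pe_isometryI:
  assumes "\<And>x. x \<in> X \<Longrightarrow> f x \<in> pe_space n p"
    and "\<And>x y. x \<in> X \<Longrightarrow> y \<in> X \<Longrightarrow> pe_form n p (f x - f y) (f x - f y) = (d x y)\<^sup>2"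
    and "\<And>x y. x \<in> X \<Longrightarrow> y \<in> X \<Longrightarrow> 0 \<le> d x y"
  shows "pe_isometry n p X d f"
  unfolding pe_isometry_def
proof (intro conjI ballI)
  show "f ` X \<subseteq> pe_space n p" using assms(1) by blast
  show "difference_set (f ` X) \<subseteq> pe_cone n p"
  proof
    fix v assume "v \<in> difference_set (f ` X)"
    then obtain x y where xy: "v = f x - f y" "x \<in> X" "y \<in> X" by (auto simp: difference_set_def)
    have "v \<in> pe_space n p"
      using assms(1)[OF xy(2)] assms(1)[OF xy(3)] by (simp add: pe_space_def xy(1))
    then show "v \<in> pe_cone n p" using assms(2)[OF xy(2,3)] by (simp add: pe_cone_def xy(1))
  qed
  show "pe_dist n p (f x) (f y) = d x y" if "x \<in> X" "y \<in> X" for x y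
    using assms(2,3)[OF that] by (simp add: pe_dist_def)
qed

lemma (in fourth_moment_measure) spectral_map_isometry:
  assumes supp: "supp \<mu> = UNIV" and sys: "nonzero_eigensystem \<mu> (T_op \<mu>) n p lam u"
  shows "pe_isometry n p UNIV dist (spectral_map \<mu> (n + p) lam u)"
proof (rule pe_isometryI)
  let ?f = "spectral_map \<mu> (n + p) lam u"
  show "?f x \<in> pe_space n p" for x by (auto simp: spectral_map_def pe_space_def)
  show "pe_form n p (?f x - ?f y) (?f x - ?f y) = (dist x y)\<^sup>2" for x y
  proof -
    let ?r = "\<lambda>i. cont_rep \<mu> (lam i) (u i)"
    have neg: "lam i < 0" if "i \<in> {1..n}" for i
      using sys that unfolding nonzero_eigensystem_def by blast
    have pos: "lam i > 0" if "i \<in> {n+1..n+p}" for i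
      using sys that unfolding nonzero_eigensystem_def by blast
    have "pe_form n p (?f x - ?f y) (?f x - ?f y) = (\<Sum>i\<in>{1..n+p}. lam i * (?r i x - ?r i y)\<^sup>2)"
      unfolding pe_form_signed_sum
    proof (rule sum.cong[OF refl])
      fix i assume i: "i \<in> {1..n+p}"
      \<comment> \<open>The ordering of the eigenvalues, negative ones first, makes the sign of the
        form agree with that of \<open>lam i\<close>.\<close>
      have "signature_sign n i * \<bar>lam i\<bar> = lam i"
        using neg[of i] pos[of i] i by (auto simp: signature_sign_def)
      then have sq: "signature_sign n i * (sqrt \<bar>lam i\<bar>)\<^sup>2 = lam i" by simp
      have diff: "(?f x - ?f y) i = sqrt \<bar>lam i\<bar> * (?r i x - ?r i y)"
        using i by (simp add: spectral_map_def right_diff_distrib)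
      have "signature_sign n i * (?f x - ?f y) i * (?f x - ?f y) i
          = signature_sign n i * (sqrt \<bar>lam i\<bar>)\<^sup>2 * (?r i x - ?r i y)\<^sup>2"
        unfolding diff by (simp only: power2_eq_square mult_ac)
      then show "signature_sign n i * (?f x - ?f y) i * (?f x - ?f y) i = lam i * (?r i x - ?r i y)\<^sup>2"
        by (simp only: sq)
    qed
    also have "\<dots> = kern_T \<mu> x x + kern_T \<mu> y y - 2 * kern_T \<mu> x y"
      unfolding kern_T_expansion[OF supp sys]
      by (simp add: sum_distrib_left power2_eq_square algebra_simps flip: sum.distrib sum_subtractf)
    also have "\<dots> = (dist x y)\<^sup>2" by (rule kern_T_refl_diff)
    finally show ?thesis .
  qed
qed simp

section \<open>Counting eigenvalues of one sign\<close>

text \<open>Gaussian elimination, by induction on the set of equations; \<open>M k j\<close> is the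
  coefficient of the unknown \<open>k\<close> in the equation \<open>j\<close>.\<close>

lemma homogeneous_system_nontrivial_solution:
  fixes M :: "'i \<Rightarrow> 'j \<Rightarrow> real"
  assumes "finite J" "finite I" "card J < card I"
  shows "\<exists>a. (\<exists>k\<in>I. a k \<noteq> 0) \<and> (\<forall>j\<in>J. (\<Sum>k\<in>I. a k * M k j) = 0)"
  using assms
proof (induction J arbitrary: I M rule: finite_induct)
  case empty
  then have "I \<noteq> {}" by auto
  then show ?case by (intro exI[of _ "\<lambda>_. 1"]) auto
next
  case (insert j J)
  show ?case
  proof (cases "\<forall>k\<in>I. M k j = 0")
    case True
    have "card J < card I" using insert by simp
    then obtain a where "\<exists>k\<in>I. a k \<noteq> 0" "\<forall>j\<in>J. (\<Sum>k\<in>I. a k * M k j) = 0"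
      using insert.IH[of I M] insert.prems(1) by blast
    then show ?thesis using True by (intro exI[of _ a]) simp
  next
    case False
    then obtain k0 where k0: "k0 \<in> I" "M k0 j \<noteq> 0" by blast
    define I' where "I' = I - {k0}"
    define M' where "M' k i = M k i - M k j / M k0 j * M k0 i" for k i
    have "card J < card I'" "finite I'"
      using insert k0(1) by (simp_all add: I'_def)
    then obtain a where a: "\<exists>k\<in>I'. a k \<noteq> 0" "\<forall>i\<in>J. (\<Sum>k\<in>I'. a k * M' k i) = 0"
      using insert.IH[of I' M'] by blast
    \<comment> \<open>The eliminated unknown receives the value that satisfies the pivot equation
      \<open>j\<close>.\<close>
    define b where "b = a(k0 := - (\<Sum>k\<in>I'. a k * M k j) / M k0 j)"
    have b: "(\<Sum>k\<in>I. b k * M k i) = (\<Sum>k\<in>I'. a k * M' k i)" for i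
    proof -
      have "(\<Sum>k\<in>I. b k * M k i) = b k0 * M k0 i + (\<Sum>k\<in>I'. b k * M k i)"
        unfolding I'_def by (rule sum.remove[OF insert.prems(1) k0(1)])
      also have "(\<Sum>k\<in>I'. b k * M k i) = (\<Sum>k\<in>I'. a k * M k i)"
        by (rule sum.cong) (auto simp: b_def I'_def)
      also have "b k0 * M k0 i = - (\<Sum>k\<in>I'. a k * (M k j / M k0 j * M k0 i))"
        by (simp add: b_def sum_distrib_right sum_divide_distrib mult.assoc flip: sum_negf)
      finally show ?thesis
        by (simp add: M'_def right_diff_distrib sum_subtractf)
    qed
    have "(\<Sum>k\<in>I. b k * M k i) = 0" if "i \<in> insert j J" for i
    proof (cases "i = j")
      case True
      then show ?thesis using k0(2) unfolding b by (simp add: M'_def)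
    next
      case False
      then show ?thesis using a(2) that unfolding b by simp
    qed
    moreover have "\<exists>k\<in>I. b k \<noteq> 0" using a(1) by (auto simp: b_def I'_def)
    ultimately show ?thesis by blast
  qed
qed

text \<open>A finite lower bound of a supremum in \<open>enat\<close> is reached by a member:
  \<open>Suc j \<le>\<close> supremum means \<open>j <\<close> supremum, so some set has more than
  \<open>j\<close> elements.\<close>

lemma eigen_mult_witness:
  assumes "enat k \<le> eigen_mult \<mu> A c"
  shows "\<exists>S. finite S \<and> S \<subseteq> eigenspace \<mu> A c \<and> L2_independent \<mu> S \<and> k \<le> card S"
proof (cases k)
  case 0
  then show ?thesis by (intro exI[of _ "{}"]) (simp add: L2_independent_def)
next
  case (Suc j)
  then have "enat j < eigen_mult \<mu> A c"
    using assms by (metis Suc_ile_eq)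
  then show ?thesis unfolding eigen_mult_def less_SUP_iff using Suc by auto
qed

text \<open>Distributes a finite total over the summands. A single infinite summand can take all of
  \<open>N\<close>; otherwise the summands themselves serve.\<close>

lemma enat_sum_le_witness:
  fixes e :: "'c \<Rightarrow> enat"
  assumes F: "finite F" and le: "enat N \<le> (\<Sum>c\<in>F. e c)"
  shows "\<exists>k. (\<forall>c\<in>F. enat (k c) \<le> e c) \<and> N \<le> (\<Sum>c\<in>F. k c)"
proof (cases "\<exists>c\<in>F. e c = \<infinity>")
  case True
  then obtain c where c: "c \<in> F" "e c = \<infinity>" by blast
  then show ?thesis
    using F by (intro exI[of _ "\<lambda>i. if i = c then N else 0"]) (auto simp: zero_enat_def[symmetric])
next
  case False
  then have e: "enat (the_enat (e c)) = e c" if "c \<in> F" for c using that by (cases "e c") auto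
  have "enat (\<Sum>c\<in>G. the_enat (e c)) = (\<Sum>c\<in>G. e c)" if "G \<subseteq> F" for G
    using finite_subset[OF that F] that
    by (induction G rule: finite_induct) (simp_all add: zero_enat_def e flip: plus_enat_simps(1))
  then have "N \<le> (\<Sum>c\<in>F. the_enat (e c))" using le by (metis enat_ord_simps(1) subset_refl)
  then show ?thesis using e by (intro exI[of _ "\<lambda>c. the_enat (e c)"]) simp
qed

section \<open>Eigenspaces and the bound on their total dimension\<close>

context dominated_kernel
begin

lemma eigenspace_L2: "u \<in> eigenspace \<mu> Kop c \<Longrightarrow> u \<in> L2 \<mu>"
  by (simp add: eigenspace_def)

lemma eigenspace_lincomb:
  assumes "finite S" and S: "S \<subseteq> eigenspace \<mu> Kop c"
  shows "(\<lambda>x. \<Sum>v\<in>S. a v * v x) \<in> eigenspace \<mu> Kop c"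
proof -
  have L: "(\<lambda>x. a v * v x) \<in> L2 \<mu>" if "v \<in> S" for v
    using that S by (intro L2_scale eigenspace_L2) blast
  have "AE x in \<mu>. \<forall>v\<in>S. Kop v x = c * v x"
    using S by (intro AE_finite_allI[OF assms(1)]) (auto simp: eigenspace_def)
  then have "AE x in \<mu>. Kop (\<lambda>x. \<Sum>v\<in>S. a v * v x) x = c * (\<Sum>v\<in>S. a v * v x)"
  proof eventually_elim
    case (elim x)
    have "Kop (\<lambda>x. \<Sum>v\<in>S. a v * v x) x = (\<Sum>v\<in>S. a v * Kop v x)"
      using Kop_sum[of S "\<lambda>v x. a v * v x" x] L by (simp add: Kop_scale)
    then show ?case using elim by (simp add: sum_distrib_left mult.left_commute)
  qed
  then show ?thesis using L2_sum[OF L] by (simp add: eigenspace_def)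
qed

lemma Kop_inner_eigen:
  assumes u: "u \<in> eigenspace \<mu> Kop c" and v: "v \<in> L2 \<mu>"
  shows "L2_inner \<mu> (Kop u) v = c * L2_inner \<mu> u v"
proof -
  have uL: "u \<in> L2 \<mu>" by (rule eigenspace_L2[OF u])
  have "L2_inner \<mu> (Kop u) v = L2_inner \<mu> (\<lambda>x. c * u x) v"
    by (rule L2_inner_cong)
      (use u v uL in \<open>simp_all add: eigenspace_def L2_measurable Kop_L2 L2_scale\<close>)
  then show ?thesis by (simp add: L2_inner_scale_left)
qed

lemma eigenspace_orthogonal:
  assumes u: "u \<in> eigenspace \<mu> Kop c" and v: "v \<in> eigenspace \<mu> Kop d" and "c \<noteq> d"
  shows "L2_inner \<mu> u v = 0"
proof -
  have "c * L2_inner \<mu> u v = d * L2_inner \<mu> u v"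
    using Kop_inner_eigen[OF u eigenspace_L2[OF v]] Kop_inner_eigen[OF v eigenspace_L2[OF u]]
      Kop_symmetric[OF eigenspace_L2[OF u] eigenspace_L2[OF v]]
    by (simp add: L2_inner_commute)
  then show ?thesis using assms(3) by simp
qed

text \<open>Were the total multiplicity larger than \<open>card J\<close>, some nontrivial
  combination of eigenfunctions would be orthogonal to every \<open>\<psi> j\<close>. Its form,
  times \<open>s\<close>, is then nonpositive by \<open>semi\<close>, but it is also a sum of
  positive multiples of squared norms, so all components are null. With \<open>s\<close> equal to 1
  or -1 this treats both signs.\<close>

lemma sum_eigen_mult_le:
  fixes s :: real and \<psi> :: "'j \<Rightarrow> 'a \<Rightarrow> real"
  assumes J: "finite J" and \<psi>: "\<And>j. j \<in> J \<Longrightarrow> \<psi> j \<in> L2 \<mu>"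
    and semi: "\<And>v. v \<in> L2 \<mu> \<Longrightarrow> (\<forall>j\<in>J. L2_inner \<mu> v (\<psi> j) = 0) \<Longrightarrow> s * L2_inner \<mu> (Kop v) v \<le> 0"
    and F: "finite F" and sF: "\<And>c. c \<in> F \<Longrightarrow> s * c > 0"
  shows "(\<Sum>c\<in>F. eigen_mult \<mu> Kop c) \<le> enat (card J)"
proof (rule ccontr)
  assume "\<not> ?thesis"
  then have "enat (Suc (card J)) \<le> (\<Sum>c\<in>F. eigen_mult \<mu> Kop c)"
    by (simp add: Suc_ile_eq)
  then obtain k where k: "\<And>c. c \<in> F \<Longrightarrow> enat (k c) \<le> eigen_mult \<mu> Kop c" "card J < (\<Sum>c\<in>F. k c)"
    using enat_sum_le_witness[OF F] by (metis Suc_le_eq)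
  have "\<forall>c\<in>F. \<exists>S. finite S \<and> S \<subseteq> eigenspace \<mu> Kop c \<and> L2_independent \<mu> S \<and> k c \<le> card S"
    using eigen_mult_witness k(1) by blast
  then obtain S where "\<forall>c\<in>F. finite (S c) \<and> S c \<subseteq> eigenspace \<mu> Kop c \<and> L2_independent \<mu> (S c) \<and> k c \<le> card (S c)"
    by metis
  then have S: "\<And>c. c \<in> F \<Longrightarrow> finite (S c)" "\<And>c. c \<in> F \<Longrightarrow> S c \<subseteq> eigenspace \<mu> Kop c"
      "\<And>c. c \<in> F \<Longrightarrow> L2_independent \<mu> (S c)" "\<And>c. c \<in> F \<Longrightarrow> k c \<le> card (S c)"
    by auto
  \<comment> \<open>Tagging each function with its eigenvalue makes the index set a disjoint union,
    whose cardinality is the sum of the \<open>card (S c)\<close>.\<close>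
  define I where "I = Sigma F S"
  have "(\<Sum>c\<in>F. k c) \<le> card I"
    unfolding I_def using S(1,4) F by (simp add: sum_mono)
  then have cI: "card J < card I" using k(2) by simp
  have finI: "finite I" unfolding I_def using F S(1) by blast
  obtain a where a: "\<exists>i\<in>I. a i \<noteq> 0" "\<forall>j\<in>J. (\<Sum>i\<in>I. a i * L2_inner \<mu> (snd i) (\<psi> j)) = 0"
    using homogeneous_system_nontrivial_solution[OF J finI cI, of "\<lambda>i j. L2_inner \<mu> (snd i) (\<psi> j)"]
    by blast
  define W where "W c = (\<lambda>x. \<Sum>v\<in>S c. a (c, v) * v x)" for c
  have WE: "W c \<in> eigenspace \<mu> Kop c" if "c \<in> F" for c
    unfolding W_def by (rule eigenspace_lincomb[OF S(1,2)[OF that]])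
  have WL: "W c \<in> L2 \<mu>" if "c \<in> F" for c by (rule eigenspace_L2[OF WE[OF that]])
  define v where "v = (\<lambda>x. \<Sum>c\<in>F. W c x)"
  have vL: "v \<in> L2 \<mu>" unfolding v_def by (rule L2_sum[OF WL])
  have "L2_inner \<mu> v (\<psi> j) = 0" if j: "j \<in> J" for j
  proof -
    have SL: "z \<in> L2 \<mu>" if "c \<in> F" "z \<in> S c" for c z using S(2) that eigenspace_L2 by blast
    have "L2_inner \<mu> v (\<psi> j) = (\<Sum>c\<in>F. L2_inner \<mu> (W c) (\<psi> j))"
      unfolding v_def by (rule L2_inner_sum_left[OF WL \<psi>[OF j]])
    also have "\<dots> = (\<Sum>c\<in>F. \<Sum>z\<in>S c. a (c, z) * L2_inner \<mu> z (\<psi> j))"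
    proof (rule sum.cong[OF refl])
      fix c assume c: "c \<in> F"
      show "L2_inner \<mu> (W c) (\<psi> j) = (\<Sum>z\<in>S c. a (c, z) * L2_inner \<mu> z (\<psi> j))"
        unfolding W_def
        by (subst L2_inner_sum_left) (simp_all add: L2_scale SL[OF c] \<psi> j L2_inner_scale_left)
    qed
    also have "\<dots> = (\<Sum>i\<in>I. a i * L2_inner \<mu> (snd i) (\<psi> j))"
      unfolding I_def by (subst sum.Sigma) (use F S(1) in \<open>auto simp: case_prod_beta\<close>)
    finally show ?thesis using a(2) j by simp
  qed
  then have le0: "s * L2_inner \<mu> (Kop v) v \<le> 0" using semi[OF vL] by blast
  have Kv: "Kop v = (\<lambda>x. \<Sum>c\<in>F. Kop (W c) x)"
    unfolding v_def by (rule ext) (rule Kop_sum[OF WL])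
  have "L2_inner \<mu> (Kop v) v = (\<Sum>c\<in>F. L2_inner \<mu> (Kop (W c)) v)"
    unfolding Kv by (rule L2_inner_sum_left[OF Kop_L2[OF WL] vL])
  \<comment> \<open>Eigenspaces for different eigenvalues are orthogonal, so only the diagonal terms
    survive.\<close>
  also have "\<dots> = (\<Sum>c\<in>F. c * L2_inner \<mu> (W c) (W c))"
  proof (rule sum.cong[OF refl])
    fix c assume c: "c \<in> F"
    have "L2_inner \<mu> (W c) v = (\<Sum>d\<in>F. L2_inner \<mu> (W c) (W d))"
      unfolding v_def by (rule L2_inner_sum_right[OF WL WL[OF c]])
    also have "\<dots> = (\<Sum>d\<in>F. if d = c then L2_inner \<mu> (W c) (W c) else 0)"
      by (rule sum.cong[OF refl]) (use eigenspace_orthogonal[OF WE[OF c] WE] in auto)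
    also have "\<dots> = L2_inner \<mu> (W c) (W c)" using F c by simp
    finally show "L2_inner \<mu> (Kop (W c)) v = c * L2_inner \<mu> (W c) (W c)"
      using Kop_inner_eigen[OF WE[OF c] vL] by simp
  qed
  finally have sum_le: "(\<Sum>c\<in>F. s * c * L2_inner \<mu> (W c) (W c)) \<le> 0"
    using le0 by (simp add: sum_distrib_left mult.assoc)
  have nn: "0 \<le> s * c * L2_inner \<mu> (W c) (W c)" if "c \<in> F" for c
    by (rule mult_nonneg_nonneg) (use sF[OF that] L2_inner_self_nonneg in auto)
  have W0: "AE x in \<mu>. W c x = 0" if c: "c \<in> F" for c
  proof -
    have "s * c * L2_inner \<mu> (W c) (W c) \<le> 0"
      using member_le_sum[OF c _ F, of "\<lambda>c. s * c * L2_inner \<mu> (W c) (W c)"] nn sum_le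
      by simp
    then have "s * c * L2_inner \<mu> (W c) (W c) = 0" using nn[OF c] by linarith
    then have "L2_inner \<mu> (W c) (W c) = 0" using sF[OF c] by auto
    then show ?thesis using L2_inner_self_eq_0[OF WL[OF c]] by blast
  qed
  have "a (c, z) = 0" if "c \<in> F" "z \<in> S c" for c z
    using S(3)[OF that(1)] W0[OF that(1)] that(2) unfolding L2_independent_def W_def by fast
  then show False using a(1) by (auto simp: I_def)
qed

end

section \<open>Measurable coordinates of an isometry\<close>

text \<open>
  Skeleton decomposition, by Gaussian elimination with pivot \<open>B x0 y0\<close>.  The coefficients
  \<open>\<alpha> i\<close> inherit the regularity \<open>S\<close> of the sections \<open>B _ y\<close>, whatever the factors \<open>P\<close> and \<open>Q\<close>
  are.
\<close>

lemma finite_rank_skeleton: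
  fixes B :: "'a \<Rightarrow> 'b \<Rightarrow> real" and P :: "'j \<Rightarrow> 'a \<Rightarrow> real"
  assumes "finite J" and "\<And>x y. B x y = (\<Sum>j\<in>J. P j x * Q j y)"
    and zero: "(\<lambda>x. 0) \<in> S" and add: "\<And>f g. f \<in> S \<Longrightarrow> g \<in> S \<Longrightarrow> (\<lambda>x. f x + g x) \<in> S"
    and scale: "\<And>f c. f \<in> S \<Longrightarrow> (\<lambda>x. c * f x) \<in> S"
    and "\<And>y. (\<lambda>x. B x y) \<in> S"
  shows "\<exists>(r::nat) z \<alpha>. (\<forall>i<r. \<alpha> i \<in> S) \<and> (\<forall>x y. B x y = (\<Sum>i<r. \<alpha> i x * B (z i) y))"
  using assms(1,2,6)
proof (induction "card J" arbitrary: J B P Q)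
  case 0
  then show ?case by (intro exI[of _ 0]) simp
next
  case (Suc m)
  show ?case
  proof (cases "\<forall>x y. B x y = 0")
    case True
    then show ?thesis by (intro exI[of _ 0]) simp
  next
    case False
    then obtain x0 y0 where b: "B x0 y0 \<noteq> 0" by blast
    have "\<exists>j\<in>J. Q j y0 \<noteq> 0"
    proof (rule ccontr)
      assume "\<not> ?thesis"
      then have "B x0 y0 = 0" by (simp add: Suc.prems(2)[of x0 y0])
      with b show False by simp
    qed
    then obtain j where j: "j \<in> J" "Q j y0 \<noteq> 0" by blast
    \<comment> \<open>Subtracting the rank-one term through the pivot makes
      \<open>B' x y0 = 0\<close> for all \<open>x\<close>.\<close>
    define B' where "B' x y = B x y - B x y0 * B x0 y / B x0 y0" for x y
    define P' where "P' i x = P i x - P i x0 * B x y0 / B x0 y0" for i x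
    define Q' where "Q' i y = Q i y - Q i y0 / Q j y0 * Q j y" for i y
    have B'P': "B' x y = (\<Sum>i\<in>J. P' i x * Q i y)" for x y
    proof -
      have "(\<Sum>i\<in>J. P' i x * Q i y) = (\<Sum>i\<in>J. P i x * Q i y - (B x y0 / B x0 y0) * (P i x0 * Q i y))"
        by (rule sum.cong) (simp_all add: P'_def algebra_simps)
      also have "\<dots> = B x y - (B x y0 / B x0 y0) * B x0 y"
        by (simp only: sum_subtractf sum_distrib_left[symmetric] Suc.prems(2)[symmetric])
      finally show ?thesis by (simp add: B'_def)
    qed
    \<comment> \<open>This linear relation among the \<open>P' i\<close> allows \<open>Q\<close> to
      be replaced by \<open>Q'\<close> in the sum; since \<open>Q' j\<close> vanishes, the index
      \<open>j\<close> drops out.\<close>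
    have z: "(\<Sum>i\<in>J. P' i x * Q i y0) = 0" for x
      using B'P'[of x y0] b by (simp add: B'_def)
    have B'Q': "B' x y = (\<Sum>i\<in>J - {j}. P' i x * Q' i y)" for x y
    proof -
      have "(\<Sum>i\<in>J. P' i x * Q' i y)
          = (\<Sum>i\<in>J. P' i x * Q i y) - (\<Sum>i\<in>J. P' i x * Q i y0) * (Q j y / Q j y0)"
        unfolding Q'_def sum_distrib_right by (simp add: right_diff_distrib mult.assoc flip: sum_subtractf)
      also have "\<dots> = B' x y" by (simp add: z B'P')
      finally show ?thesis
        using sum.remove[OF Suc.prems(1) j(1), of "\<lambda>i. P' i x * Q' i y"] j(2) by (simp add: Q'_def)
    qed
    have B'S: "(\<lambda>x. B' x y) \<in> S" for y
      using add[OF Suc.prems(3)[of y] scale[OF Suc.prems(3)[of y0], of "- B x0 y / B x0 y0"]]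
      by (simp add: B'_def mult.commute)
    have "m = card (J - {j})" "finite (J - {j})" using Suc.hyps(2) Suc.prems(1) j(1) by simp_all
    then obtain r :: nat and z \<alpha> where IH: "\<And>i. i < r \<Longrightarrow> \<alpha> i \<in> S"
        "\<And>x y. B' x y = (\<Sum>i<r. \<alpha> i x * B' (z i) y)"
      using Suc.hyps(1)[of "J - {j}" B' P' Q'] B'Q' B'S by blast
    define \<beta> where "\<beta> x = B x y0 / B x0 y0 - (\<Sum>i<r. \<alpha> i x * (B (z i) y0 / B x0 y0))" for x
    have \<beta>S: "\<beta> \<in> S"
    proof -
      have sumS: "(\<lambda>x. \<Sum>i<k. c i * \<alpha> i x) \<in> S" if "k \<le> r" for c k
        using that by (induction k) (auto intro!: zero add scale IH(1))
      have "(\<lambda>x. (1 / B x0 y0) * B x y0 + (\<Sum>i<r. (- B (z i) y0 / B x0 y0) * \<alpha> i x)) \<in> S"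
        by (intro add scale Suc.prems(3) sumS) simp
      also have "(\<lambda>x. (1 / B x0 y0) * B x y0 + (\<Sum>i<r. (- B (z i) y0 / B x0 y0) * \<alpha> i x)) = \<beta>"
        by (simp add: \<beta>_def fun_eq_iff sum_negf mult.commute)
      finally show ?thesis .
    qed
    have dec: "B x y = (\<Sum>i<r. \<alpha> i x * B (z i) y) + \<beta> x * B x0 y" for x y
    proof -
      have "B x y = (\<Sum>i<r. \<alpha> i x * B' (z i) y) + B x y0 * B x0 y / B x0 y0"
        using IH(2)[of x y] by (simp add: B'_def)
      also have "(\<Sum>i<r. \<alpha> i x * B' (z i) y) = (\<Sum>i<r. \<alpha> i x * B (z i) y)
          - (\<Sum>i<r. \<alpha> i x * (B (z i) y0 / B x0 y0)) * B x0 y"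
        by (simp add: B'_def right_diff_distrib sum_subtractf sum_distrib_right mult.assoc)
      finally show ?thesis by (simp add: \<beta>_def left_diff_distrib)
    qed
    show ?thesis
    proof (intro exI conjI allI impI)
      show "(\<alpha>(r := \<beta>)) i \<in> S" if "i < Suc r" for i using that IH(1) \<beta>S by (auto simp: less_Suc_eq)
      show "B x y = (\<Sum>i<Suc r. (\<alpha>(r := \<beta>)) i x * B ((z(r := x0)) i) y)" for x y
      proof -
        have "(\<Sum>i<r. (\<alpha>(r := \<beta>)) i x * B ((z(r := x0)) i) y) = (\<Sum>i<r. \<alpha> i x * B (z i) y)"
          by (rule sum.cong) auto
        then show ?thesis using dec[of x y] by simp
      qed
    qed
  qed
qed

section \<open>The quadratic form of an isometrically embedded space\<close>

context fourth_moment_measure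
begin

text \<open>Polarisation expresses \<open>kern\<close> through a Gram kernel \<open>B\<close> of the
  form and two functions of one variable, which double centring removes. What remains is a signed
  sum of products \<open>\<psi> i x * \<psi> i y\<close>.\<close>

lemma isometry_quadratic_form:
  fixes f :: "'a \<Rightarrow> nat \<Rightarrow> real"
  assumes f: "pe_isometry n p UNIV dist f"
  shows "\<exists>\<psi>. (\<forall>i. \<psi> i \<in> L2 \<mu>) \<and> (\<forall>v\<in>L2 \<mu>.
    L2_inner \<mu> (T.Kop v) v = (\<Sum>i\<in>{1..n+p}. signature_sign n i * (L2_inner \<mu> v (\<psi> i))\<^sup>2))"
proof -
  let ?I = "{1..n+p}" and ?\<sigma> = "signature_sign n"
  \<comment> \<open>Moving the image of \<open>x0\<close> to the origin makes \<open>B x x\<close>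
    the square-integrable function \<open>sq_dist\<close>.\<close>
  define F where "F x = f x - f x0" for x
  define B where "B x y = pe_form n p (F x) (F y)" for x y
  have d2: "pe_form n p (f x - f y) (f x - f y) = (dist x y)\<^sup>2" for x y
  proof -
    have "f x - f y \<in> pe_cone n p"
      using f unfolding pe_isometry_def difference_set_def by blast
    moreover have "sqrt (pe_form n p (f x - f y) (f x - f y)) = dist x y"
      using f by (simp add: pe_isometry_def pe_dist_def)
    ultimately show ?thesis by (metis (no_types, lifting) mem_Collect_eq pe_cone_def real_sqrt_pow2)
  qed
  have Bx: "B x x = sq_dist x" for x
    using d2[of x x0] by (simp add: B_def F_def sq_dist_def dist_commute)
  have Bsym: "B x y = B y x" for x y
    unfolding B_def pe_form_signed_sum by (simp add: mult_ac)
  have "pe_form n p (f x - f y) (f x - f y) = B x x + B y y - 2 * B x y" for x y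
    unfolding B_def pe_form_signed_sum F_def
    by (simp add: sum_distrib_left algebra_simps flip: sum.distrib sum_subtractf)
  then have kB: "kern x y = B x y - sq_dist x / 2 - sq_dist y / 2" for x y
    using d2[of x y] by (simp add: kern_def Bx)
  \<comment> \<open>The sections of \<open>B\<close> are determined by the metric, so they are
    measurable even if \<open>f\<close> is not.\<close>
  have BS: "(\<lambda>x. B x y) \<in> L2 \<mu>" for y
  proof -
    have "(\<lambda>x. (kern y x + (1/2) * sq_dist x) + sq_dist y / 2) \<in> L2 \<mu>"
      by (intro L2_add L2_scale L2_const K.row_L2 sq_dist_L2)
    moreover have "(\<lambda>x. (kern y x + (1/2) * sq_dist x) + sq_dist y / 2) = (\<lambda>x. B x y)"
      by (simp add: fun_eq_iff kB Bsym[of y])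
    ultimately show ?thesis by simp
  qed
  have BF: "B x y = (\<Sum>i\<in>?I. (?\<sigma> i * F x i) * F y i)" for x y
    by (simp add: B_def pe_form_signed_sum)
  have "\<exists>(r::nat) z \<alpha>. (\<forall>i<r. \<alpha> i \<in> L2 \<mu>) \<and> (\<forall>x y. B x y = (\<Sum>i<r. \<alpha> i x * B (z i) y))"
    by (rule finite_rank_skeleton[OF _ BF L2_zero L2_add L2_scale BS]) simp
  then obtain r :: nat and z \<alpha> where \<alpha>: "\<And>k. k < r \<Longrightarrow> \<alpha> k \<in> L2 \<mu>"
      "\<And>x y. B x y = (\<Sum>k<r. \<alpha> k x * B (z k) y)"
    by blast
  \<comment> \<open>The point \<open>F x\<close> is replaced by the combination of the nodes
    \<open>F (z k)\<close> with coefficients \<open>\<alpha> k x\<close>. Using the skeleton in both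
    variables shows that the Gram kernel is unchanged.\<close>
  define \<Phi> where "\<Phi> i x = (\<Sum>k<r. F (z k) i * \<alpha> k x)" for i x
  have \<Phi>L: "\<Phi> i \<in> L2 \<mu>" for i
    unfolding \<Phi>_def by (intro L2_sum L2_scale \<alpha>(1)) simp
  have B\<Phi>: "B x y = (\<Sum>i\<in>?I. ?\<sigma> i * \<Phi> i x * \<Phi> i y)" for x y
  proof -
    have "(\<Sum>i\<in>?I. ?\<sigma> i * \<Phi> i x * \<Phi> i y)
        = (\<Sum>i\<in>?I. \<Sum>k<r. \<Sum>l<r. \<alpha> k x * (\<alpha> l y * (?\<sigma> i * F (z l) i * F (z k) i)))"
      unfolding \<Phi>_def by (simp add: sum_distrib_left sum_distrib_right mult_ac)
    also have "\<dots> = (\<Sum>k<r. \<Sum>i\<in>?I. \<Sum>l<r. \<alpha> k x * (\<alpha> l y * (?\<sigma> i * F (z l) i * F (z k) i)))"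
      by (rule sum.swap)
    also have "\<dots> = (\<Sum>k<r. \<Sum>l<r. \<Sum>i\<in>?I. \<alpha> k x * (\<alpha> l y * (?\<sigma> i * F (z l) i * F (z k) i)))"
      by (intro sum.cong[OF refl] sum.swap)
    also have "\<dots> = (\<Sum>k<r. \<alpha> k x * (\<Sum>l<r. \<alpha> l y * B (z l) (z k)))"
      by (simp only: B_def pe_form_signed_sum sum_distrib_left)
    also have "\<dots> = (\<Sum>k<r. \<alpha> k x * B y (z k))"
      by (simp only: \<alpha>(2)[of y, symmetric])
    also have "\<dots> = B x y"
      by (simp only: Bsym[of y] \<alpha>(2)[of x, symmetric])
    finally show ?thesis by simp
  qed
  define m where "m i = L2_inner \<mu> (\<Phi> i) (\<lambda>_. 1)" for i
  \<comment> \<open>Subtracting the means moves the barycentre to the origin, which is the effect of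
    double centring on a Gram kernel.\<close>
  define \<psi> where "\<psi> i x = \<Phi> i x - m i" for i x
  define Q where "Q = L2_inner \<mu> sq_dist (\<lambda>_. 1)"
  have \<psi>L: "\<psi> i \<in> L2 \<mu>" for i
    unfolding \<psi>_def by (intro L2_diff L2_const \<Phi>L)
  have 1: "(\<lambda>_. 1) \<in> L2 \<mu>" by (rule L2_const)
  have cL: "(\<lambda>_. c) \<in> L2 \<mu>" for c by (rule L2_const)
  have c1: "L2_inner \<mu> (\<lambda>_. c) (\<lambda>_. 1) = c" for c by (simp add: L2_inner_def prob_space)
  have row_mean_eq: "row_mean x = (\<Sum>i\<in>?I. ?\<sigma> i * m i * \<Phi> i x) - sq_dist x / 2 - Q / 2" for x
  proof -
    have row: "kern x = (\<lambda>y. ((\<Sum>i\<in>?I. (?\<sigma> i * \<Phi> i x) * \<Phi> i y) - sq_dist x / 2) - (1/2) * sq_dist y)"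
      by (simp add: fun_eq_iff kB B\<Phi>)
    have sL: "(\<lambda>y. \<Sum>i\<in>?I. (?\<sigma> i * \<Phi> i x) * \<Phi> i y) \<in> L2 \<mu>" by (intro L2_sum L2_scale \<Phi>L)
    have "L2_inner \<mu> (\<lambda>y. \<Sum>i\<in>?I. (?\<sigma> i * \<Phi> i x) * \<Phi> i y) (\<lambda>_. 1) = (\<Sum>i\<in>?I. ?\<sigma> i * \<Phi> i x * m i)"
      by (subst L2_inner_sum_left) (auto simp: L2_scale \<Phi>L 1 L2_inner_scale_left m_def)
    then show ?thesis
      unfolding row_mean_def K.Kop_def row
      by (simp only: L2_inner_diff_left L2_diff sL cL sq_dist_L2 L2_scale 1 L2_inner_scale_left c1
          Q_def[symmetric]) (simp add: mult_ac)
  qed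
  have A_eq: "L2_inner \<mu> row_mean (\<lambda>_. 1) = (\<Sum>i\<in>?I. ?\<sigma> i * m i * m i) - Q"
  proof -
    have row: "row_mean = (\<lambda>x. ((\<Sum>i\<in>?I. (?\<sigma> i * m i) * \<Phi> i x) - (1/2) * sq_dist x) - Q / 2)"
      by (simp add: fun_eq_iff row_mean_eq)
    have sL: "(\<lambda>y. \<Sum>i\<in>?I. (?\<sigma> i * m i) * \<Phi> i y) \<in> L2 \<mu>" by (intro L2_sum L2_scale \<Phi>L)
    have "L2_inner \<mu> (\<lambda>y. \<Sum>i\<in>?I. (?\<sigma> i * m i) * \<Phi> i y) (\<lambda>_. 1) = (\<Sum>i\<in>?I. ?\<sigma> i * m i * m i)"
      by (subst L2_inner_sum_left) (auto simp: L2_scale \<Phi>L 1 L2_inner_scale_left m_def)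
    then show ?thesis
      unfolding row
      by (simp only: L2_inner_diff_left L2_diff sL cL sq_dist_L2 L2_scale 1 L2_inner_scale_left c1
          Q_def[symmetric])
  qed
  have kT: "kern_T \<mu> x y = (\<Sum>i\<in>?I. (?\<sigma> i * \<psi> i x) * \<psi> i y)" for x y
  proof -
    have "(\<Sum>i\<in>?I. (?\<sigma> i * \<psi> i x) * \<psi> i y) = (\<Sum>i\<in>?I. ?\<sigma> i * \<Phi> i x * \<Phi> i y)
        - (\<Sum>i\<in>?I. ?\<sigma> i * m i * \<Phi> i x) - (\<Sum>i\<in>?I. ?\<sigma> i * m i * \<Phi> i y) + (\<Sum>i\<in>?I. ?\<sigma> i * m i * m i)"
      unfolding \<psi>_def by (simp add: algebra_simps flip: sum.distrib sum_subtractf)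
    then show ?thesis
      unfolding kern_T_eq A_eq row_mean_eq[of x] row_mean_eq[of y] kB B\<Phi> by simp
  qed
  have "L2_inner \<mu> (T.Kop v) v = (\<Sum>i\<in>?I. ?\<sigma> i * (L2_inner \<mu> v (\<psi> i))\<^sup>2)" if v: "v \<in> L2 \<mu>" for v
  proof -
    have row: "kern_T \<mu> x = (\<lambda>y. \<Sum>i\<in>?I. (?\<sigma> i * \<psi> i x) * \<psi> i y)" for x
      by (rule ext) (rule kT)
    have "T.Kop v x = (\<Sum>i\<in>?I. (?\<sigma> i * L2_inner \<mu> v (\<psi> i)) * \<psi> i x)" for x
    proof -
      have "T.Kop v x = (\<Sum>i\<in>?I. L2_inner \<mu> (\<lambda>y. (?\<sigma> i * \<psi> i x) * \<psi> i y) v)"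
        unfolding T.Kop_def row by (rule L2_inner_sum_left) (intro L2_scale \<psi>L v)+
      then show ?thesis
        unfolding L2_inner_scale_left L2_inner_commute[of \<mu> v] by (simp only: mult_ac)
    qed
    then have "T.Kop v = (\<lambda>x. \<Sum>i\<in>?I. (?\<sigma> i * L2_inner \<mu> v (\<psi> i)) * \<psi> i x)" by (rule ext)
    then have "L2_inner \<mu> (T.Kop v) v
        = (\<Sum>i\<in>?I. L2_inner \<mu> (\<lambda>x. (?\<sigma> i * L2_inner \<mu> v (\<psi> i)) * \<psi> i x) v)"
      using L2_inner_sum_left[of ?I "\<lambda>i x. (?\<sigma> i * L2_inner \<mu> v (\<psi> i)) * \<psi> i x" \<mu> v]
      by (simp only: L2_scale \<psi>L v)
    then show ?thesis
      by (simp only: L2_inner_scale_left L2_inner_commute[of \<mu> "\<psi> _" v] power2_eq_square mult.assoc)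
  qed
  then show ?thesis using \<psi>L by blast
qed

text \<open>On functions orthogonal to the first \<open>n\<close> of the \<open>\<psi> i\<close>
  only the positive squares remain, and on those orthogonal to the last \<open>p\<close> only the
  negative ones; the dimension count applies to each.\<close>

lemma isometry_s_minus_s_plus:
  fixes f :: "'a \<Rightarrow> nat \<Rightarrow> real"
  assumes f: "pe_isometry n p UNIV dist f"
  shows "s_minus \<mu> (T_op \<mu>) \<le> enat n" "s_plus \<mu> (T_op \<mu>) \<le> enat p"
proof -
  obtain \<psi> where \<psi>: "\<And>i. \<psi> i \<in> L2 \<mu>" "\<And>v. v \<in> L2 \<mu> \<Longrightarrow>
      L2_inner \<mu> (T.Kop v) v = (\<Sum>i\<in>{1..n+p}. signature_sign n i * (L2_inner \<mu> v (\<psi> i))\<^sup>2)"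
    using isometry_quadratic_form[OF f] by blast
  have mult: "eigen_mult \<mu> (T_op \<mu>) c = eigen_mult \<mu> T.Kop c" for c
    unfolding eigen_mult_def eigenspace_T_op by (simp add: eigenspace_def)
  show "s_minus \<mu> (T_op \<mu>) \<le> enat n"
    unfolding s_minus_def mult
  proof (rule SUP_least)
    fix F assume F: "F \<in> {F. finite F \<and> F \<subseteq> {..<0::real}}"
    have "(\<Sum>c\<in>F. eigen_mult \<mu> T.Kop c) \<le> enat (card {1..n})"
    proof (rule T.sum_eigen_mult_le[of "{1..n}" \<psi> "- 1"])
      fix v assume v: "v \<in> L2 \<mu>" "\<forall>j\<in>{1..n}. L2_inner \<mu> v (\<psi> j) = 0"
      have "0 \<le> L2_inner \<mu> (T.Kop v) v"
        unfolding \<psi>(2)[OF v(1)] by (rule sum_nonneg) (use v(2) in \<open>auto simp: signature_sign_def\<close>)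
      then show "- 1 * L2_inner \<mu> (T.Kop v) v \<le> 0" by simp
    qed (use F \<psi>(1) in auto)
    then show "(\<Sum>c\<in>F. eigen_mult \<mu> T.Kop c) \<le> enat n" by simp
  qed
  show "s_plus \<mu> (T_op \<mu>) \<le> enat p"
    unfolding s_plus_def mult
  proof (rule SUP_least)
    fix F assume F: "F \<in> {F. finite F \<and> F \<subseteq> {0::real<..}}"
    have "(\<Sum>c\<in>F. eigen_mult \<mu> T.Kop c) \<le> enat (card {n+1..n+p})"
    proof (rule T.sum_eigen_mult_le[of "{n+1..n+p}" \<psi> 1])
      fix v assume v: "v \<in> L2 \<mu>" "\<forall>j\<in>{n+1..n+p}. L2_inner \<mu> v (\<psi> j) = 0"
      have "L2_inner \<mu> (T.Kop v) v \<le> 0"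
        unfolding \<psi>(2)[OF v(1)] by (rule sum_nonpos) (use v(2) in \<open>auto simp: signature_sign_def\<close>)
      then show "1 * L2_inner \<mu> (T.Kop v) v \<le> 0" by simp
    qed (use F \<psi>(1) in auto)
    then show "(\<Sum>c\<in>F. eigen_mult \<mu> T.Kop c) \<le> enat p" by simp
  qed
qed

end

section \<open>Embedding finite metric spaces\<close>

text \<open>
  For unit vectors \<open>e\<close> indexed by \<open>Y\<close>, the form \<open>- \<Sum>a,b. \<delta> a b ^ 2 / 2 * z a * z b\<close> takes the value
  \<open>\<delta> x y ^ 2\<close> at \<open>z = e x - e y\<close>, and \<open>8 * (- z a * z b / 2) = (z a - z b)^2 - (z a + z b)^2\<close>.
\<close>

lemma finite_metric_pe_isometry:
  assumes "Metric_space Y \<delta>" and Y: "finite Y"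
  shows "\<exists>n p f. pe_isometry n p Y \<delta> f"
proof -
  interpret Metric_space Y \<delta> by fact
  define N where "N = card (Y \<times> Y)"
  have "finite (Y \<times> Y)" using Y by simp
  then obtain h where h: "bij_betw h {1..N} (Y \<times> Y)"
    unfolding N_def using ex_bij_betw_nat_finite_1 by blast
  define e where "e x a = (if a = x then 1 else 0 :: real)" for x a :: 'a
  define g where "g s x = (\<lambda>(a, b). \<delta> a b / sqrt 8 * (e x a + s * e x b))" for s x
  \<comment> \<open>One coordinate per ordered pair in each block. The first block enters
    \<open>pe_form\<close> with a minus sign, so it carries the sums (\<open>s = 1\<close>) and the
    second block the differences.\<close>
  define f where "f x i = (if i \<in> {1..N} then g 1 x (h i)
      else if i \<in> {N+1..N+N} then g (- 1) x (h (i - N)) else 0)" for x i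
  have "pe_isometry N N Y \<delta> f"
  proof (rule pe_isometryI)
    show "f x \<in> pe_space N N" for x by (auto simp: pe_space_def f_def)
    fix x y assume xy: "x \<in> Y" "y \<in> Y"
    define u where "u a = e x a - e y a" for a
    have g2: "(g s x (a, b) - g s y (a, b))\<^sup>2 = (\<delta> a b)\<^sup>2 / 8 * (u a + s * u b)\<^sup>2" for s a b
    proof -
      have "g s x (a, b) - g s y (a, b) = \<delta> a b / sqrt 8 * (u a + s * u b)"
        by (simp add: g_def u_def algebra_simps)
      then show ?thesis by (simp add: power_mult_distrib power_divide)
    qed
    have sum_h: "(\<Sum>i=1..N. (g s x (h i) - g s y (h i))\<^sup>2)
        = (\<Sum>a\<in>Y. \<Sum>b\<in>Y. (\<delta> a b)\<^sup>2 / 8 * (u a + s * u b)\<^sup>2)" for s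
    proof -
      have "(\<Sum>i=1..N. (g s x (h i) - g s y (h i))\<^sup>2) = (\<Sum>c\<in>Y \<times> Y. (g s x c - g s y c)\<^sup>2)"
        by (rule sum.reindex_bij_betw[OF h])
      also have "\<dots> = (\<Sum>(a, b)\<in>Y \<times> Y. (\<delta> a b)\<^sup>2 / 8 * (u a + s * u b)\<^sup>2)"
        by (rule sum.cong) (auto simp: g2)
      finally show ?thesis by (simp add: sum.cartesian_product)
    qed
    have "(\<Sum>j=N+1..N+N. (f x j - f y j) * (f x j - f y j)) = (\<Sum>i=1..N. (g (- 1) x (h i) - g (- 1) y (h i))\<^sup>2)"
      using sum.shift_bounds_cl_nat_ivl[of "\<lambda>j. (f x j - f y j) * (f x j - f y j)" 1 N N]
      by (simp add: f_def power2_eq_square add.commute)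
    moreover have "(\<Sum>i=1..N. (f x i - f y i) * (f x i - f y i)) = (\<Sum>i=1..N. (g 1 x (h i) - g 1 y (h i))\<^sup>2)"
      by (rule sum.cong) (auto simp: f_def power2_eq_square)
    ultimately have "pe_form N N (f x - f y) (f x - f y)
        = (\<Sum>a\<in>Y. \<Sum>b\<in>Y. (\<delta> a b)\<^sup>2 / 8 * (u a + (- 1) * u b)\<^sup>2 - (\<delta> a b)\<^sup>2 / 8 * (u a + 1 * u b)\<^sup>2)"
      unfolding pe_form_def fun_diff_def sum_h sum_subtractf by simp
    also have "\<dots> = (\<Sum>a\<in>Y. \<Sum>b\<in>Y. (- (1/2) * (\<delta> a b)\<^sup>2 * u a) * u b)"
      by (intro sum.cong[OF refl]) (simp add: power2_eq_square algebra_simps)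
    \<comment> \<open>As \<open>u\<close> is \<open>e x - e y\<close>, each summation only evaluates
      at \<open>x\<close> and subtracts the value at \<open>y\<close>. After both, the diagonal
      distances vanish and two halves of \<open>(\<delta> x y)\<^sup>2\<close> remain.\<close>
    also have "\<dots> = (\<Sum>a\<in>Y. (- (1/2) * (\<delta> a x)\<^sup>2 + (1/2) * (\<delta> a y)\<^sup>2) * u a)"
    proof (rule sum.cong[OF refl])
      fix a
      have "(\<Sum>b\<in>Y. (- (1/2) * (\<delta> a b)\<^sup>2 * u a) * u b)
          = (\<Sum>b\<in>Y. if b = x then - (1/2) * (\<delta> a b)\<^sup>2 * u a else 0)
            - (\<Sum>b\<in>Y. if b = y then - (1/2) * (\<delta> a b)\<^sup>2 * u a else 0)"
        unfolding sum_subtractf[symmetric] by (rule sum.cong) (auto simp: u_def e_def)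
      also have "\<dots> = (- (1/2) * (\<delta> a x)\<^sup>2 + (1/2) * (\<delta> a y)\<^sup>2) * u a"
        using Y xy by (simp add: algebra_simps)
      finally show "(\<Sum>b\<in>Y. (- (1/2) * (\<delta> a b)\<^sup>2 * u a) * u b)
          = (- (1/2) * (\<delta> a x)\<^sup>2 + (1/2) * (\<delta> a y)\<^sup>2) * u a" .
    qed
    also have "\<dots> = (\<Sum>a\<in>Y. if a = x then - (1/2) * (\<delta> a x)\<^sup>2 + (1/2) * (\<delta> a y)\<^sup>2 else 0)
        - (\<Sum>a\<in>Y. if a = y then - (1/2) * (\<delta> a x)\<^sup>2 + (1/2) * (\<delta> a y)\<^sup>2 else 0)"
      unfolding sum_subtractf[symmetric] by (rule sum.cong) (auto simp: u_def e_def)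
    also have "\<dots> = (\<delta> x y)\<^sup>2"
      using Y xy by (simp add: commute[of y x])
    finally show "pe_form N N (f x - f y) (f x - f y) = (\<delta> x y)\<^sup>2" .
  qed simp
  then show ?thesis by blast
qed

theorem theorem5p6:
  assumes separable: "separable_space (euclidean :: 'a::metric_space topology)"
  shows
    "(\<forall>(\<mu> :: 'a measure) n p lam u.
        borel_prob \<mu> \<and> supp \<mu> = UNIV \<and> finite_4th_moment \<mu> \<and>
        s_minus \<mu> (T_op \<mu>) = enat n \<and> s_plus \<mu> (T_op \<mu>) = enat p \<and>
        nonzero_eigensystem \<mu> (T_op \<mu>) n p lam u \<longrightarrow>
        pe_isometry n p UNIV dist (spectral_map \<mu> (n + p) lam u)) \<and>
     (\<forall>(Y :: 'b set) \<delta>.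
        Metric_space Y \<delta> \<and> finite Y \<longrightarrow>
        (\<exists>n p f. pe_isometry n p Y \<delta> f)) \<and>
     (\<forall>(\<mu> :: 'a measure) n p.
        borel_prob \<mu> \<and> finite_4th_moment \<mu> \<and>
        (\<exists>f. pe_isometry n p (UNIV :: 'a set) dist f) \<longrightarrow>
        s_minus \<mu> (T_op \<mu>) \<le> enat n \<and> s_plus \<mu> (T_op \<mu>) \<le> enat p)"
proof -
  obtain D :: "'a set" where D: "countable D" "closure D = UNIV"
    using separable by (auto simp: separable_space_def)
  \<comment> \<open>The dense set is fixed once from separability, while the base point comes with
    the moment condition of each measure.\<close>
  have measure: "\<exists>x0. fourth_moment_measure \<mu> x0 D"
    if "borel_prob \<mu>" "finite_4th_moment \<mu>" for \<mu> :: "'a measure"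
    using that D
    by (auto simp: borel_prob_def finite_4th_moment_def fourth_moment_measure_def
        fourth_moment_measure_axioms_def)
  show ?thesis
  proof (intro conjI allI impI)
    show "pe_isometry n p UNIV dist (spectral_map \<mu> (n + p) lam u)"
      if "borel_prob \<mu> \<and> supp \<mu> = UNIV \<and> finite_4th_moment \<mu> \<and>
        s_minus \<mu> (T_op \<mu>) = enat n \<and> s_plus \<mu> (T_op \<mu>) = enat p \<and>
        nonzero_eigensystem \<mu> (T_op \<mu>) n p lam u" for \<mu> :: "'a measure" and n p lam u
      using that measure fourth_moment_measure.spectral_map_isometry by blast
    show "\<exists>n p f. pe_isometry n p Y \<delta> f" if "Metric_space Y \<delta> \<and> finite Y" for Y :: "'b set" and \<delta>
      using that finite_metric_pe_isometry by blast
    fix \<mu> :: "'a measure" and n p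
    assume "borel_prob \<mu> \<and> finite_4th_moment \<mu> \<and> (\<exists>f. pe_isometry n p (UNIV :: 'a set) dist f)"
    then obtain x0 f where "fourth_moment_measure \<mu> x0 D" "pe_isometry n p (UNIV :: 'a set) dist f"
      using measure by blast
    then show "s_minus \<mu> (T_op \<mu>) \<le> enat n" "s_plus \<mu> (T_op \<mu>) \<le> enat p"
      using fourth_moment_measure.isometry_s_minus_s_plus by blast+
  qed
qed

end
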